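(* Let $\Omega\subset\mathbb{C}$ be a domain that is conformally equivalent to the unit disc $\mathbb{D}$, and let $f$ be analytic in $\Omega$ such that $f(\Omega)$ has finite area $A(f)=\int\!\!\int_{\Omega}|f'(z)|^2\,dx\,dy<+\infty$. Then, for any hyperbolic geodesic segment $\gamma$ in $\Omega$, $$\mathcal{E}\big(f(\gamma)\big)\ \leqslant\ \sqrt{\frac{A(f)}{\pi}\,\mathcal{H}(\gamma)},$$ where $\mathcal{E}(f(\gamma))=\int_\gamma|f'(z)|\,|dz|$ is the Euclidean length of $f(\gamma)$ and $\mathcal{H}(\gamma)$ is the hyperbolic length of $\gamma$ in $\Omega$. In particular, if $\Omega$ has finite Euclidean area $A$, then $\pi\,\mathcal{E}(\gamma)^2\leqslant A\,\mathcal{H}(\gamma)$, where $\mathcal{E}(\gamma)$ is the Euclidean length of $\gamma$.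
   Context: The hyperbolic metric on $\mathbb{D}=\{|z|<1\}$ has density $\lambda_{\mathbb{D}}(z)=2/(1-|z|^2)$. For a simply connected proper subdomain $\Omega$ of $\mathbb{C}$ the hyperbolic density $\lambda_\Omega$ is defined by $\lambda_\Omega(g(z))|g'(z)|=\lambda_{\mathbb{D}}(z)$ for any conformal map $g$ of $\mathbb{D}$ onto $\Omega$; the hyperbolic length of a curve $\gamma$ in $\Omega$ is $\int_\gamma\lambda_\Omega(z)\,|dz|$, and geodesics are taken with respect to this metric. The area $A(f)$ of the image counts multiplicity. *)

theory Defs
  imports "HOL-Complex_Analysis.Complex_Analysis"
begin

definition conformal_onto :: "(complex \<Rightarrow> complex) \<Rightarrow> complex set \<Rightarrow> complex set \<Rightarrow> bool" where
  "conformal_onto g U V \<longleftrightarrow> g holomorphic_on U \<and> inj_on g U \<and> g ` U = V"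

definition disc_density :: "complex \<Rightarrow> real" where
  "disc_density z = 2 / (1 - (cmod z)\<^sup>2)"

text \<open>The value is meaningful when \<open>\<Omega>\<close> is a conformal image of the unit disc; by the
  Schwarz--Pick lemma it then does not depend on the conformal map, so the description has
  exactly one solution for each \<open>w \<in> \<Omega>\<close>.\<close>

definition hyp_density :: "complex set \<Rightarrow> complex \<Rightarrow> real" where
  "hyp_density \<Omega> w = (THE d. \<forall>g z. conformal_onto g (ball 0 1) \<Omega> \<and> z \<in> ball 0 1 \<and> g z = w
      \<longrightarrow> d * cmod (deriv g z) = disc_density z)"

text \<open>The integral of \<open>\<rho>\<close> along \<open>\<gamma>\<close> with respect to arc length. The library's
  piecewise \<open>C\<^sup>1\<close> paths (\<^const>\<open>valid_path\<close>) need not be rectifiable, since the derivative may be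
  unbounded near an exceptional point. An extended nonnegative integral assigns such paths
  length \<open>\<infinity>\<close>, where a real-valued integral would give them length 0 and spoil the
  minimisation below. The finitely many points without a derivative form a null set.\<close>

definition arc_integral :: "(complex \<Rightarrow> real) \<Rightarrow> (real \<Rightarrow> complex) \<Rightarrow> ennreal" where
  "arc_integral \<rho> \<gamma> =
     (\<integral>\<^sup>+ t \<in> {0..1}. ennreal (\<rho> (\<gamma> t) * cmod (vector_derivative \<gamma> (at t))) \<partial>lborel)"

definition euclidean_length :: "(real \<Rightarrow> complex) \<Rightarrow> ennreal" where
  "euclidean_length \<gamma> = arc_integral (\<lambda>_. 1) \<gamma>"

definition euclidean_length_image :: "(complex \<Rightarrow> complex) \<Rightarrow> (real \<Rightarrow> complex) \<Rightarrow> ennreal" where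
  "euclidean_length_image f \<gamma> = arc_integral (\<lambda>z. cmod (deriv f z)) \<gamma>"

definition hyp_length :: "complex set \<Rightarrow> (real \<Rightarrow> complex) \<Rightarrow> ennreal" where
  "hyp_length \<Omega> \<gamma> = arc_integral (hyp_density \<Omega>) \<gamma>"

text \<open>Curves of least hyperbolic length between their endpoints. No normalisation of the
  parametrisation is imposed. In the hyperbolic plane locally and globally shortest curves
  coincide.\<close>

definition hyp_geodesic_segment :: "complex set \<Rightarrow> (real \<Rightarrow> complex) \<Rightarrow> bool" where
  "hyp_geodesic_segment \<Omega> \<gamma> \<longleftrightarrow>
     valid_path \<gamma> \<and> path_image \<gamma> \<subseteq> \<Omega> \<and>
     (\<forall>\<eta>. valid_path \<eta> \<and> path_image \<eta> \<subseteq> \<Omega> \<and>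
          pathstart \<eta> = pathstart \<gamma> \<and> pathfinish \<eta> = pathfinish \<gamma>
        \<longrightarrow> hyp_length \<Omega> \<gamma> \<le> hyp_length \<Omega> \<eta>)"

definition image_area :: "(complex \<Rightarrow> complex) \<Rightarrow> complex set \<Rightarrow> ennreal" where
  "image_area f \<Omega> = (\<integral>\<^sup>+ z \<in> \<Omega>. ennreal ((cmod (deriv f z))\<^sup>2) \<partial>lborel)"

definition ennreal_sqrt :: "ennreal \<Rightarrow> ennreal" where
  "ennreal_sqrt x = (if x = \<infinity> then \<infinity> else ennreal (sqrt (enn2real x)))"

lemma euclidean_length_image_eq:
  assumes "open \<Omega>" "f holomorphic_on \<Omega>" "valid_path \<gamma>" "path_image \<gamma> \<subseteq> \<Omega>"
  shows "euclidean_length_image f \<gamma> = euclidean_length (f \<circ> \<gamma>)"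
proof -
  obtain S where S: "finite S" "\<gamma> C1_differentiable_on ({0..1} - S)"
    using assms(3) unfolding valid_path_def piecewise_C1_differentiable_on_def by blast
  have eq: "cmod (deriv f (\<gamma> t)) * cmod (vector_derivative \<gamma> (at t)) =
            cmod (vector_derivative (f \<circ> \<gamma>) (at t))" if t: "t \<in> {0..1} - S" for t
  proof -
    have d: "\<gamma> differentiable at t"
      using S(2) t by (auto simp: C1_differentiable_on_eq)
    have "\<gamma> t \<in> \<Omega>"
      using assms(4) t by (auto simp: path_image_def)
    then have "f field_differentiable at (\<gamma> t)"
      using assms(1,2) holomorphic_on_imp_differentiable_at by blast
    with d show ?thesis
      by (simp add: vector_derivative_chain_at_general norm_mult mult.commute)
  qed
  have "AE t in lborel. t \<notin> S"
    by (rule AE_not_in) (use S(1) finite_imp_null_set_lborel in blast)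
  then show ?thesis
    unfolding euclidean_length_image_def euclidean_length_def arc_integral_def
    by (intro nn_integral_cong_AE) (auto elim!: eventually_mono simp: eq split: split_indicator)
qed

end

theory Submission
  imports Defs
begin

text \<open>Composing a conformal map of the disc onto \<open>\<Omega>\<close> with a disc automorphism, we may assume that
  the geodesic joins \<open>0\<close> to some \<open>r \<in> [0, 1)\<close> in the unit disc, so that its hyperbolic length is
  \<open>ln ((1 + r) / (1 - r))\<close>. Let \<open>h\<close> be \<open>f\<close> composed with this map, with Taylor coefficients \<open>a n\<close>.
  Then \<open>A(f)\<close> is at least \<open>pi * (\<Sum>n. n * |a n|\<^sup>2)\<close>, while the image of the geodesic has length at most
  \<open>\<Sum>n\<ge>1. |a n| * r ^ n\<close>. By Cauchy--Schwarz the square of the latter is at most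
  \<open>(\<Sum>n. n * |a n|\<^sup>2) * (\<Sum>n\<ge>1. r ^ (2 * n) / n)\<close>, and the second factor is
  \<open>- ln (1 - r\<^sup>2) \<le> ln ((1 + r) / (1 - r))\<close>.\<close>

subsection \<open>Conformal change of variables\<close>

text \<open>A geodesic is given here only as a length minimiser: nothing fixes its parametrisation,
  and it may pause or change speed. The radius therefore cannot simply be substituted for it. What
  is shown instead is that integrals along a minimiser are controlled by primitives evaluated at its
  two endpoints, which is all that the length estimate uses.

  Expanding about an endpoint of the geodesic makes \<open>z ^ n\<close> nonnegative along it, so
  \<open>|h'(x)|\<close> is dominated by the series with coefficients \<open>n * |a n|\<close>, and
  the arguments of the coefficients no longer matter. The weight \<open>n\<close> in Cauchy--Schwarz
  is chosen so that one factor is area and the other a logarithm, hence comparable with hyperbolic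
  distance. The two logarithms differ by \<open>2 * ln (1 + r)\<close>, which is less than
  \<open>2 * ln 2\<close>, so little is lost on long geodesics.

  The area enters only as an upper bound for partial sums of the coefficient series; one inequality
  between area and coefficients is enough.\<close>

definition c2v :: "complex \<Rightarrow> real^2" where
  "c2v z = vector [Re z, Im z]"

definition v2c :: "real^2 \<Rightarrow> complex" where
  "v2c v = Complex (v $ 1) (v $ 2)"

lemma c2v_v2c [simp]: "c2v (v2c v) = v" "v2c (c2v z) = z"
  by (auto simp: c2v_def v2c_def vec_eq_iff forall_2 complex_eq_iff)

lemma bounded_linear_v2c: "bounded_linear v2c"
  by (intro linear_conv_bounded_linear[THEN iffD1] linearI) (auto simp: v2c_def complex_eq_iff)

lemma bounded_linear_c2v: "bounded_linear c2v"
  by (intro linear_conv_bounded_linear[THEN iffD1] linearI)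
     (auto simp: c2v_def vec_eq_iff forall_2)

lemma v2c_measurable [measurable]: "v2c \<in> borel_measurable borel"
  by (intro borel_measurable_continuous_onI linear_continuous_on bounded_linear_v2c)

lemma borel_measurable_ennreal_times_indicator:
  fixes f :: "'a::euclidean_space \<Rightarrow> real"
  assumes "open A" "continuous_on A f"
  shows "(\<lambda>x. ennreal (f x) * indicator A x) \<in> borel_measurable borel"
proof -
  have "(\<lambda>x. indicator A x *\<^sub>R f x) \<in> borel_measurable borel"
    using assms by (intro borel_measurable_continuous_on_indicator) auto
  then have "(\<lambda>x. ennreal (indicator A x *\<^sub>R f x)) \<in> borel_measurable borel"
    by measurable
  moreover have "(\<lambda>x. ennreal (indicator A x *\<^sub>R f x)) = (\<lambda>x. ennreal (f x) * indicator A x)"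
    by (auto simp: indicator_def)
  ultimately show ?thesis by (simp only:)
qed

lemma prod_Basis_complex: "(\<Prod>b\<in>Basis. ((u::complex) - l) \<bullet> b) = (Re u - Re l) * (Im u - Im l)"
  by (simp add: Basis_complex_def)

lemma box_complex: "z \<in> box l u \<longleftrightarrow> Re l < Re z \<and> Re z < Re u \<and> Im l < Im z \<and> Im z < Im u"
  by (auto simp: mem_box Basis_complex_def)

text \<open>Jacobian determinants are computed in \<open>real^2\<close>, so area has to be moved
  there from \<open>complex\<close>. Lebesgue measure is determined by its values on boxes, and
  \<open>v2c\<close> matches boxes with equal side lengths.\<close>

lemma lborel_v2c: "lborel = distr (lborel :: (real^2) measure) borel v2c"
proof (rule lborel_eqI)
  fix l u :: complex
  assume lu: "\<And>b. b \<in> Basis \<Longrightarrow> l \<bullet> b \<le> u \<bullet> b"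
  have lu': "Re l \<le> Re u" "Im l \<le> Im u" using lu[of 1] lu[of \<i>] by (auto simp: Basis_complex_def)
  have le: "\<forall>i. c2v l $ i \<le> c2v u $ i" using lu' by (simp add: forall_2 c2v_def)
  have "v2c -` box l u = box (c2v l) (c2v u)"
    by (auto simp: box_complex mem_box_cart v2c_def c2v_def forall_2)
  then have "emeasure (distr lborel borel v2c) (box l u) = emeasure lborel (box (c2v l) (c2v u))"
    by (subst emeasure_distr) auto
  also have "\<dots> = (\<Prod>b\<in>Basis. (c2v u - c2v l) \<bullet> b)"
    using le by (intro emeasure_lborel_box) (auto simp: Basis_vec_def inner_axis)
  also have "(\<Prod>b\<in>Basis. (c2v u - c2v l) \<bullet> b) = (\<Prod>i\<in>UNIV. (c2v u - c2v l) $ i)"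
    by (simp add: Basis_vec_def inner_axis UNION_singleton_eq_range prod.reindex inj_on_def axis_eq_axis)
  also have "\<dots> = (\<Prod>b\<in>Basis. (u - l) \<bullet> b)"
    by (simp add: prod_Basis_complex UNIV_2 c2v_def)
  finally show "emeasure (distr lborel borel v2c) (box l u) = (\<Prod>b\<in>Basis. (u - l) \<bullet> b)" .
qed simp

lemma Complex_measurable [measurable]: "(\<lambda>(x,y). Complex x y) \<in> borel_measurable (borel \<Otimes>\<^sub>M borel)"
  unfolding borel_prod by (intro borel_measurable_continuous_onI) (auto simp: case_prod_unfold intro!: continuous_intros)

text \<open>The same box criterion, now against the product measure; it makes iterated integration
  over real and imaginary parts available.\<close>

lemma lborel_Complex: "lborel = distr (lborel \<Otimes>\<^sub>M lborel) borel (\<lambda>(x,y). Complex x y)"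
proof (rule lborel_eqI)
  fix l u :: complex
  assume lu: "\<And>b. b \<in> Basis \<Longrightarrow> l \<bullet> b \<le> u \<bullet> b"
  have lu': "Re l \<le> Re u" "Im l \<le> Im u" using lu[of 1] lu[of \<i>] by (auto simp: Basis_complex_def)
  have "(\<lambda>(x,y). Complex x y) -` box l u = {Re l<..<Re u} \<times> {Im l<..<Im u}"
    by (auto simp: box_complex)
  then have "emeasure (distr (lborel \<Otimes>\<^sub>M lborel) borel (\<lambda>(x,y). Complex x y)) (box l u) 
    = emeasure (lborel \<Otimes>\<^sub>M lborel) ({Re l<..<Re u} \<times> {Im l<..<Im u})"
    by (subst emeasure_distr) (auto simp: space_pair_measure)
  also have "\<dots> = (\<Prod>b\<in>Basis. (u - l) \<bullet> b)"
    using lu' by (simp add: lborel.emeasure_pair_measure_Times prod_Basis_complex ennreal_mult)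
  finally show "emeasure (distr (lborel \<Otimes>\<^sub>M lborel) borel (\<lambda>(x,y). Complex x y)) (box l u) = (\<Prod>b\<in>Basis. (u - l) \<bullet> b)" .
qed simp

lemma nn_integral_v2c:
  assumes "f \<in> borel_measurable borel"
  shows "(\<integral>\<^sup>+z. f z \<partial>lborel) = (\<integral>\<^sup>+v. f (v2c v) \<partial>lborel)"
  using assms by (subst lborel_v2c) (simp add: nn_integral_distr)

lemma nn_integral_Complex:
  assumes [measurable]: "f \<in> borel_measurable borel"
  shows "(\<integral>\<^sup>+z. f z \<partial>lborel) = (\<integral>\<^sup>+x. \<integral>\<^sup>+y. f (Complex x y) \<partial>lborel \<partial>lborel)"
proof -
  have "(\<integral>\<^sup>+z. f z \<partial>lborel) = (\<integral>\<^sup>+p. f (Complex (fst p) (snd p)) \<partial>(lborel \<Otimes>\<^sub>M lborel))"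
    by (subst lborel_Complex) (simp add: nn_integral_distr case_prod_unfold)
  also have "\<dots> = (\<integral>\<^sup>+x. \<integral>\<^sup>+y. f (Complex x y) \<partial>lborel \<partial>lborel)"
    by (subst lborel.nn_integral_fst [symmetric]) (auto simp: case_prod_unfold)
  finally show ?thesis .
qed

text \<open>Multiplication by \<open>x + \<i>*y\<close> has rows \<open>(x, -y)\<close> and
  \<open>(y, x)\<close>; this is the Jacobian of a holomorphic map with derivative
  \<open>d\<close>.\<close>

lemma det_matrix_v2c_mult:
  "det (matrix (\<lambda>h. c2v (d * v2c h))) = (cmod d)\<^sup>2"
  by (simp add: det_2 matrix_def c2v_def v2c_def axis_def cmod_power2 flip: power2_eq_square)

text \<open>Conjugating \<open>G\<close> by \<open>c2v\<close> and \<open>v2c\<close> gives a real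
  map with Jacobian \<open>|G'|\<^sup>2\<close>, to which the change-of-variables theorem applies.
  That theorem concerns absolutely integrable functions; the finiteness assumption on the image side
  supplies integrability, and the result is then read back as an extended nonnegative
  integral.\<close>

lemma nn_integral_conformal_image:
  assumes U: "open U" "G holomorphic_on U" "inj_on G U"
    and \<phi>: "continuous_on (G ` U) \<phi>" "\<And>z. 0 \<le> (\<phi> z :: real)"
    and fin: "(\<integral>\<^sup>+z\<in>G ` U. ennreal (\<phi> z) \<partial>lborel) < \<infinity>"
  shows "(\<integral>\<^sup>+w\<in>U. ennreal (\<phi> (G w) * (cmod (deriv G w))\<^sup>2) \<partial>lborel)
       = (\<integral>\<^sup>+z\<in>G ` U. ennreal (\<phi> z) \<partial>lborel)"
proof -
  define V where "V = c2v ` U"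
  define g where "g = (\<lambda>v. c2v (G (v2c v)))"
  define \<psi> where "\<psi> = (\<lambda>v. \<phi> (v2c v))"
  define J where "J = (\<lambda>v. (cmod (deriv G (v2c v)))\<^sup>2)"
  have oGU: "open (G ` U)"
    using open_mapping_thm3 U by blast
  have V: "V = v2c -` U" unfolding V_def by force
  have gV: "g ` V = v2c -` (G ` U)" 
  proof (intro equalityI subsetI)
    fix v assume "v \<in> v2c -` (G ` U)"
    then obtain w where w: "w \<in> U" "v2c v = G w" by auto
    then have "v = g (c2v w)" by (metis c2v_v2c g_def)
    with w show "v \<in> g ` V" by (auto simp: V)
  qed (auto simp: g_def V)
  have oV: "open V" unfolding V
    by (intro open_vimage U linear_continuous_on bounded_linear_v2c)
  have ogV: "open (g ` V)" unfolding gV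
    by (intro open_vimage oGU linear_continuous_on bounded_linear_v2c)
  have der: "(g has_derivative (\<lambda>h. c2v (deriv G (v2c v) * v2c h))) (at v within V)" if "v \<in> V" for v
  proof -
    have "(G has_field_derivative deriv G (v2c v)) (at (v2c v))"
      using U that by (auto simp: V holomorphic_derivI)
    then have "(G has_derivative (\<lambda>h. deriv G (v2c v) * h)) (at (v2c v) within v2c ` V)"
      by (auto simp: has_field_derivative_def intro: has_derivative_at_withinI)
    from has_derivative_in_compose[OF bounded_linear_imp_has_derivative[OF bounded_linear_v2c] this]
    have "((\<lambda>v. G (v2c v)) has_derivative (\<lambda>h. deriv G (v2c v) * v2c h)) (at v within V)" .
    from bounded_linear.has_derivative[OF bounded_linear_c2v this]
    show ?thesis unfolding g_def .
  qed
  have inj: "inj_on g V"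
    using U(3) unfolding g_def V inj_on_def by (metis c2v_v2c vimageE)
  have meas_phi: "(\<lambda>z. ennreal (\<phi> z) * indicator (G ` U) z) \<in> borel_measurable borel"
    using oGU \<phi>(1) by (rule borel_measurable_ennreal_times_indicator)
  have cG: "continuous_on U G" using U by (simp add: holomorphic_on_imp_continuous_on)
  have cdG: "continuous_on U (deriv G)" using U by (intro holomorphic_on_imp_continuous_on holomorphic_deriv)
  have meas_J: "(\<lambda>w. ennreal (\<phi> (G w) * (cmod (deriv G w))\<^sup>2) * indicator U w) \<in> borel_measurable borel"
    using U by (intro borel_measurable_ennreal_times_indicator continuous_intros cdG
        continuous_on_compose2[OF \<phi>(1) cG]) auto
  obtain A where A: "A \<ge> 0" "(\<integral>\<^sup>+z\<in>G ` U. ennreal (\<phi> z) \<partial>lborel) = ennreal A"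
    using fin by (metis ennreal_cases infinity_ennreal_def less_irrefl)
  have "ennreal A = (\<integral>\<^sup>+v. ennreal (\<phi> (v2c v)) * indicator (G ` U) (v2c v) \<partial>lborel)"
    using A(2) nn_integral_v2c[OF meas_phi] by simp
  also have "\<dots> = (\<integral>\<^sup>+v\<in>g ` V. ennreal (\<psi> v) \<partial>lborel)"
    by (intro nn_integral_cong) (auto simp: gV \<psi>_def indicator_def)
  finally have A': "(\<integral>\<^sup>+v\<in>g ` V. ennreal (\<psi> v) \<partial>lborel) = ennreal A" ..
  have "continuous_on (g ` V) \<psi>"
    unfolding \<psi>_def gV
    by (intro continuous_on_compose2[OF \<phi>(1)] linear_continuous_on bounded_linear_v2c) auto
  then have meas_psi: "(\<lambda>v. indicator (g ` V) v *\<^sub>R \<psi> v) \<in> borel_measurable borel"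
    using ogV by (intro borel_measurable_continuous_on_indicator) auto
  have "((\<lambda>v. indicator (g ` V) v *\<^sub>R \<psi> v) has_integral A) UNIV"
  proof (rule nn_integral_has_integral)
    show "(\<integral>\<^sup>+ x. ennreal (indicator (g ` V) x *\<^sub>R \<psi> x) \<partial>lborel) = ennreal A"
      unfolding A'[symmetric] by (intro nn_integral_cong) (auto simp: indicator_def)
  qed (use meas_psi \<phi> A in \<open>auto simp: \<psi>_def\<close>)
  moreover have "(\<lambda>v. indicator (g ` V) v *\<^sub>R \<psi> v) = (\<lambda>v. if v \<in> g ` V then \<psi> v else 0)"
    by (auto simp: indicator_def)
  ultimately have int: "(\<psi> has_integral A) (g ` V)"
    by (simp add: has_integral_restrict_UNIV)
  have psi0: "\<psi> v \<ge> 0" for v by (simp add: \<psi>_def \<phi>)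
  have abs: "\<psi> absolutely_integrable_on (g ` V)"
    using int psi0 by (intro nonnegative_absolutely_integrable_1) auto
  have V_leb: "V \<in> sets lebesgue" using oV by (metis borel_open sets_completionI_sets sets_lborel)
  \<comment> \<open>The change-of-variables theorem takes integrands with values in
    \<open>real^'n\<close>, so the real function is wrapped as a one-dimensional vector and
    unwrapped afterwards.\<close>
  have "(\<lambda>v. vec (\<psi> v) :: real^1) absolutely_integrable_on (g ` V) \<and> integral (g ` V) (\<lambda>v. vec (\<psi> v) :: real^1) = vec A"
    using abs int by (auto simp: absolutely_integrable_on_1_iff integral_on_1_eq integral_unique)
  then have "(\<lambda>v. \<bar>det (matrix (\<lambda>h. c2v (deriv G (v2c v) * v2c h)))\<bar> *\<^sub>R (vec (\<psi> (g v)) :: real^1)) absolutely_integrable_on V \<and>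
     integral V (\<lambda>v. \<bar>det (matrix (\<lambda>h. c2v (deriv G (v2c v) * v2c h)))\<bar> *\<^sub>R (vec (\<psi> (g v)) :: real^1)) = vec A"
    using has_absolute_integral_change_of_variables[OF V_leb der inj, of "\<lambda>v. vec (\<psi> v)" "vec A"] by blast
  then have *: "(\<lambda>v. J v * \<psi> (g v)) absolutely_integrable_on V" "integral V (\<lambda>v. J v * \<psi> (g v)) = A"
    by (auto simp: absolutely_integrable_on_1_iff integral_on_1_eq det_matrix_v2c_mult J_def)
  then have "((\<lambda>v. J v * \<psi> (g v)) has_integral A) V"
    using set_lebesgue_integral_eq_integral(1) by (auto simp: has_integral_iff)
  then have "(\<integral>\<^sup>+v. ennreal (J v * \<psi> (g v)) * indicator V v \<partial>lborel) = ennreal A"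
    by (intro nn_integral_has_integral_lebesgue') (auto simp: J_def psi0)
  also have "(\<integral>\<^sup>+v. ennreal (J v * \<psi> (g v)) * indicator V v \<partial>lborel) =
    (\<integral>\<^sup>+v. ennreal (\<phi> (G (v2c v)) * (cmod (deriv G (v2c v)))\<^sup>2) * indicator U (v2c v) \<partial>lborel)"
    by (intro nn_integral_cong) (auto simp: J_def \<psi>_def g_def V indicator_def mult.commute)
  also have "\<dots> = (\<integral>\<^sup>+w\<in>U. ennreal (\<phi> (G w) * (cmod (deriv G w))\<^sup>2) \<partial>lborel)"
    using nn_integral_v2c[OF meas_J] by simp
  finally show ?thesis using A by simp
qed

subsection \<open>Area and Taylor coefficients\<close>

lemma has_integral_cis_period:
  "((\<lambda>y. cis (of_int k * y)) has_integral (if k = 0 then of_real (2*pi) else 0)) {0..2*pi}"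
proof (cases "k = 0")
  case True
  then show ?thesis using has_integral_const_real[of "1::complex" 0 "2*pi"] by (simp add: scaleR_conv_of_real)
next
  case False
  have "((\<lambda>y. cis (of_int k * y)) has_integral 
     (cis (of_int k * (2*pi)) / (\<i> * of_int k) - cis (of_int k * 0) / (\<i> * of_int k))) {0..2*pi}"
  proof (intro fundamental_theorem_of_calculus)
    fix y :: real assume "y \<in> {0..2*pi}"
    have "((\<lambda>z. exp (\<i> * of_int k * z) / (\<i> * of_int k)) has_field_derivative exp (\<i> * of_int k * of_real y))
       (at (of_real y))"
      using False by (auto intro!: derivative_eq_intros)
    from has_vector_derivative_real_field[OF this]
    show "((\<lambda>y. cis (of_int k * y) / (\<i> * of_int k)) has_vector_derivative cis (of_int k * y)) (at y within {0..2*pi})"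
      by (simp add: cis_conv_exp mult.assoc)
  qed simp
  moreover have "cis (of_int k * (2*pi)) = 1" 
    by (metis Ints_of_int cis_multiple_2pi mult.commute)
  ultimately show ?thesis using False by simp
qed

text \<open>Parseval for finite sums: after expanding the square, only diagonal terms survive
  integration over a period. The frequencies are negative because the sums arise from
  \<open>exp (-w) ^ n\<close> on a line with \<open>Re w\<close> fixed.\<close>

lemma integral_trig_poly_norm_square:
  fixes b :: "nat \<Rightarrow> complex"
  shows "((\<lambda>y. (cmod (\<Sum>n<M. b n * cis (-(real n * y))))\<^sup>2) has_integral
     (2 * pi * (\<Sum>n<M. (cmod (b n))\<^sup>2))) {0..2*pi}"
proof -
  have sq: "complex_of_real ((cmod (\<Sum>n<M. b n * cis (-(real n * y))))\<^sup>2) =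
     (\<Sum>n<M. \<Sum>m<M. b n * cnj (b m) * cis (of_int (int m - int n) * y))" for y
  proof -
    have "complex_of_real ((cmod (\<Sum>n<M. b n * cis (-(real n * y))))\<^sup>2) =
      (\<Sum>n<M. b n * cis (-(real n * y))) * cnj (\<Sum>n<M. b n * cis (-(real n * y)))"
      by (rule complex_norm_square)
    also have "\<dots> = (\<Sum>n<M. \<Sum>m<M. (b n * cis (-(real n * y))) * (cnj (b m) * cis (real m * y)))"
      by (simp add: sum_product cis_cnj)
    also have "\<dots> = (\<Sum>n<M. \<Sum>m<M. b n * cnj (b m) * cis (of_int (int m - int n) * y))"
    proof (intro sum.cong refl)
      fix n m
      have "cis (-(real n * y)) * cis (real m * y) = cis (of_int (int m - int n) * y)"
        by (simp add: cis_mult algebra_simps)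
      then show "(b n * cis (-(real n * y))) * (cnj (b m) * cis (real m * y)) = 
         b n * cnj (b m) * cis (of_int (int m - int n) * y)"
        by (metis (no_types, lifting) mult.assoc mult.left_commute)
    qed
    finally show ?thesis .
  qed
  have "((\<lambda>y. \<Sum>n<M. \<Sum>m<M. b n * cnj (b m) * cis (of_int (int m - int n) * y)) has_integral
      (\<Sum>n<M. \<Sum>m<M. b n * cnj (b m) * (if int m - int n = 0 then of_real (2*pi) else 0))) {0..2*pi}"
    by (intro has_integral_sum has_integral_mult_right has_integral_cis_period) auto
  also have "(\<Sum>n<M. \<Sum>m<M. b n * cnj (b m) * (if int m - int n = 0 then of_real (2*pi) else 0)) =
     (\<Sum>n<M. b n * cnj (b n) * of_real (2*pi))"
    by (intro sum.cong refl) (simp add: if_distrib[of "\<lambda>x. _ * x"] cong: if_cong)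
  also have "\<dots> = of_real (2 * pi * (\<Sum>n<M. (cmod (b n))\<^sup>2))"
    by (simp add: sum_distrib_left complex_norm_square mult_ac del: of_real_power)
  finally have "((\<lambda>y. complex_of_real ((cmod (\<Sum>n<M. b n * cis (-(real n * y))))\<^sup>2)) has_integral
     complex_of_real (2 * pi * (\<Sum>n<M. (cmod (b n))\<^sup>2))) {0..2*pi}"
    unfolding sq .
  from has_integral_linear[OF this bounded_linear_Re] show ?thesis by (simp add: o_def)
qed

text \<open>Absolute summability bounds every partial sum by one constant, so dominated convergence
  passes from trigonometric polynomials to the series. Finite \<open>N\<close> is the form in which
  the coefficient sum is used later.\<close>

lemma bessel_absolutely_convergent:
  fixes b :: "nat \<Rightarrow> complex"
  assumes b: "summable (\<lambda>n. cmod (b n))"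
  defines "q \<equiv> \<lambda>y. (cmod (\<Sum>n. b n * cis (-(real n * y))))\<^sup>2"
  shows "q integrable_on {0..2*pi}" "2 * pi * (\<Sum>n<N. (cmod (b n))\<^sup>2) \<le> integral {0..2*pi} q"
proof -
  define T where "T = (\<lambda>M y. (cmod (\<Sum>n<M. b n * cis (-(real n * y))))\<^sup>2)"
  have sm: "summable (\<lambda>n. b n * cis (-(real n * y)))" for y
    by (rule summable_norm_cancel) (use b in \<open>simp add: norm_mult\<close>)
  have T: "(T M has_integral (2 * pi * (\<Sum>n<M. (cmod (b n))\<^sup>2))) {0..2*pi}" for M
    unfolding T_def by (rule integral_trig_poly_norm_square)
  have bd: "norm (T M y) \<le> (\<Sum>n. cmod (b n))\<^sup>2" for M y
  proof -
    have "cmod (\<Sum>n<M. b n * cis (-(real n * y))) \<le> (\<Sum>n<M. cmod (b n * cis (-(real n * y))))"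
      by (rule norm_sum)
    also have "\<dots> = (\<Sum>n<M. cmod (b n))" by (simp add: norm_mult)
    also have "\<dots> \<le> (\<Sum>n. cmod (b n))" using b by (intro sum_le_suminf) auto
    finally show ?thesis unfolding T_def by (simp add: power_mono)
  qed
  have lim: "(\<lambda>M. T M y) \<longlonglongrightarrow> q y" for y
    unfolding T_def q_def using summable_LIMSEQ[OF sm] by (intro tendsto_intros)
  have *: "q integrable_on {0..2*pi}" "(\<lambda>M. integral {0..2*pi} (T M)) \<longlonglongrightarrow> integral {0..2*pi} q"
    using dominated_convergence[of T "{0..2*pi}" "\<lambda>_. (\<Sum>n. cmod (b n))\<^sup>2" q] T bd lim
    by (auto simp: has_integral_integrable)
  show "q integrable_on {0..2*pi}" by fact
  show "2 * pi * (\<Sum>n<N. (cmod (b n))\<^sup>2) \<le> integral {0..2*pi} q"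
  proof (rule LIMSEQ_le_const[OF *(2)], intro exI allI impI)
    fix M assume "N \<le> M"
    then have "(\<Sum>n<N. (cmod (b n))\<^sup>2) \<le> (\<Sum>n<M. (cmod (b n))\<^sup>2)"
      by (intro sum_mono2) auto
    then show "2 * pi * (\<Sum>n<N. (cmod (b n))\<^sup>2) \<le> integral {0..2*pi} (T M)"
      using T[of M] by (simp add: integral_unique)
  qed
qed

text \<open>Integration over \<open>x\<close> turns the weight \<open>n\<^sup>2\<close>, which comes
  from the squared derivative, into the weight \<open>n\<close>: each exponential contributes
  \<open>1 / (2 * n)\<close>. For \<open>n = 0\<close> the exponential does not decay, but its
  coefficient is zero.\<close>

lemma nn_integral_exp_half_line:
  fixes d :: "nat \<Rightarrow> real"
  assumes d: "\<And>n. 0 \<le> d n"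
  shows "(\<integral>\<^sup>+x\<in>{0<..}. ennreal (2 * pi * (\<Sum>n<N. ((real n)\<^sup>2 * d n * exp (- (2 * real n) * x)))) \<partial>lborel)
     = ennreal (pi * (\<Sum>n<N. real n * d n))"
proof -
  have "((\<lambda>x. 2 * pi * (\<Sum>n<N. (real n)\<^sup>2 * d n * exp (- (2 * real n) * x))) has_integral
         2 * pi * (\<Sum>n<N. real n * d n / 2)) {0..}"
  proof (intro has_integral_mult_right has_integral_sum)
    fix n
    show "((\<lambda>x. (real n)\<^sup>2 * d n * exp (- (2 * real n) * x)) has_integral real n * d n / 2) {0..}"
    proof (cases "n = 0")
      case False
      then have "((\<lambda>x. (real n)\<^sup>2 * d n * exp (- (2 * real n) * x)) has_integral 
         (real n)\<^sup>2 * d n * (exp (- (2 * real n) * 0) / (2 * real n))) {0..}"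
        by (intro has_integral_mult_right has_integral_exp_minus_to_infinity) auto
      then show ?thesis using False by (simp add: field_simps power2_eq_square)
    qed auto
  qed auto
  then have "(\<integral>\<^sup>+x\<in>{0..}. ennreal (2 * pi * (\<Sum>n<N. ((real n)\<^sup>2 * d n * exp (- (2 * real n) * x)))) \<partial>lborel)
     = ennreal (2 * pi * (\<Sum>n<N. real n * d n / 2))"
    by (intro nn_integral_has_integral_lebesgue') (auto intro!: mult_nonneg_nonneg sum_nonneg d)
  also have "2 * pi * (\<Sum>n<N. real n * d n / 2) = pi * (\<Sum>n<N. real n * d n)"
    by (simp add: sum_distrib_left)
  also have "(\<integral>\<^sup>+x\<in>{0..}. ennreal (2 * pi * (\<Sum>n<N. ((real n)\<^sup>2 * d n * exp (- (2 * real n) * x)))) \<partial>lborel) =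
    (\<integral>\<^sup>+x\<in>{0<..}. ennreal (2 * pi * (\<Sum>n<N. ((real n)\<^sup>2 * d n * exp (- (2 * real n) * x)))) \<partial>lborel)"
    using AE_lborel_singleton[of "0::real"]
    by (intro nn_integral_cong_AE) (auto elim!: eventually_mono simp: indicator_def)
  finally show ?thesis .
qed

text \<open>On the vertical line \<open>Re w = x\<close> the function \<open>k\<close> is a Fourier
  series with coefficients \<open>n * a n * exp (-x) ^ n\<close>. Bessel's inequality on each line,
  integrated over \<open>x > 0\<close>, gives the bound.\<close>

lemma strip_area_ge:
  fixes a :: "nat \<Rightarrow> complex"
  assumes k: "continuous_on {w. 0 < Re w \<and> 0 < Im w \<and> Im w < 2*pi} k"
    and sm: "\<And>w. 0 < Re w \<Longrightarrow> summable (\<lambda>n. cmod (of_nat n * a n * exp (-w) ^ n))"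
    and k_eq: "\<And>w. 0 < Re w \<Longrightarrow> k w = (\<Sum>n. of_nat n * a n * exp (-w) ^ n)"
  shows "ennreal (pi * (\<Sum>n<N. real n * (cmod (a n))\<^sup>2)) \<le>
    (\<integral>\<^sup>+w\<in>{w. 0 < Re w \<and> 0 < Im w \<and> Im w < 2*pi}. ennreal ((cmod (k w))\<^sup>2) \<partial>lborel)"
proof -
  define V where "V = {w. 0 < Re w \<and> 0 < Im w \<and> Im w < 2*pi}"
  have "V = {w. 0 < Re w} \<inter> {w. 0 < Im w} \<inter> {w. Im w < 2*pi}" by (auto simp: V_def)
  then have oV: "open V" 
    by (simp add: open_Int open_halfspace_Re_gt open_halfspace_Im_gt open_halfspace_Im_lt)
  have meas: "(\<lambda>w. ennreal ((cmod (k w))\<^sup>2) * indicator V w) \<in> borel_measurable borel"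
    using oV k by (intro borel_measurable_ennreal_times_indicator continuous_intros) (auto simp: V_def)
  have slice: "ennreal (2 * pi * (\<Sum>n<N. ((real n)\<^sup>2 * (cmod (a n))\<^sup>2 * exp (- (2 * real n) * x)))) * indicator {0<..} x
      \<le> (\<integral>\<^sup>+y. ennreal ((cmod (k (Complex x y)))\<^sup>2) * indicator V (Complex x y) \<partial>lborel)" for x
  proof (cases "x > 0")
    case True
    define b where "b = (\<lambda>n. of_nat n * a n * of_real (exp (- x) ^ n))"
    have e: "of_nat n * a n * exp (- Complex x y) ^ n = b n * cis (-(real n * y))" for n y
    proof -
      have "exp (- Complex x y) = of_real (exp (-x)) * cis (-y)"
        by (simp add: exp_eq_polar)
      moreover have "cis (-y) ^ n = cis (-(real n * y))"
        using Complex.DeMoivre[of "-y" n] by simp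
      ultimately show ?thesis by (simp add: b_def power_mult_distrib)
    qed
    \<comment> \<open>The moduli of the terms do not depend on \<open>y\<close>, so the point with
      \<open>y = 0\<close> decides summability.\<close>
    have sb: "summable (\<lambda>n. cmod (b n))"
      using sm[of "Complex x 0"] True by (simp add: e[of _ 0])
    have b2: "(cmod (b n))\<^sup>2 = (real n)\<^sup>2 * (cmod (a n))\<^sup>2 * exp (- (2 * real n) * x)" for n
    proof -
      have "(exp (-x) ^ n)\<^sup>2 = exp (- (2 * real n) * x)"
        by (simp add: exp_of_nat_mult[symmetric] power_mult[symmetric] mult_ac)
      then show ?thesis by (simp add: b_def norm_mult power_mult_distrib norm_power)
    qed
    define q where "q = (\<lambda>y. (cmod (\<Sum>n. b n * cis (-(real n * y))))\<^sup>2)"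
    have kq: "(cmod (k (Complex x y)))\<^sup>2 = q y" for y
      using True by (simp add: k_eq e q_def)
    have "2 * pi * (\<Sum>n<N. (cmod (b n))\<^sup>2) \<le> integral {0..2*pi} q"
      unfolding q_def by (rule bessel_absolutely_convergent(2)[OF sb])
    then have "ennreal (2 * pi * (\<Sum>n<N. (cmod (b n))\<^sup>2)) \<le> ennreal (integral {0..2*pi} q)"
      by (rule ennreal_leI)
    also have "\<dots> = (\<integral>\<^sup>+y\<in>{0..2*pi}. ennreal (q y) \<partial>lborel)"
      by (rule nn_integral_has_integral_lebesgue'[symmetric])
         (use bessel_absolutely_convergent(1)[OF sb] in \<open>auto simp: q_def intro: integrable_integral\<close>)
    also have "\<dots> = (\<integral>\<^sup>+y. ennreal ((cmod (k (Complex x y)))\<^sup>2) * indicator V (Complex x y) \<partial>lborel)"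
    proof (intro nn_integral_cong_AE)
      \<comment> \<open>The closed period and the open strip differ only at \<open>y = 0\<close> and
        \<open>y = 2 * pi\<close>.\<close>
      show "AE y in lborel. ennreal (q y) * indicator {0..2*pi} y =
             ennreal ((cmod (k (Complex x y)))\<^sup>2) * indicator V (Complex x y)"
        using AE_lborel_singleton[of "0::real"] AE_lborel_singleton[of "2*pi"]
        by eventually_elim (use True in \<open>auto simp: indicator_def V_def kq\<close>)
    qed
    finally show ?thesis using True by (simp add: b2)
  qed auto
  have "ennreal (pi * (\<Sum>n<N. real n * (cmod (a n))\<^sup>2)) =
    (\<integral>\<^sup>+x\<in>{0<..}. ennreal (2 * pi * (\<Sum>n<N. ((real n)\<^sup>2 * (cmod (a n))\<^sup>2 * exp (- (2 * real n) * x)))) \<partial>lborel)"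
    by (rule nn_integral_exp_half_line[symmetric]) auto
  also have "\<dots> \<le> (\<integral>\<^sup>+x. \<integral>\<^sup>+y. ennreal ((cmod (k (Complex x y)))\<^sup>2) * indicator V (Complex x y) \<partial>lborel \<partial>lborel)"
    by (intro nn_integral_mono slice)
  also have "\<dots> = (\<integral>\<^sup>+w\<in>V. ennreal ((cmod (k w))\<^sup>2) \<partial>lborel)"
    by (rule nn_integral_Complex[OF meas, symmetric])
  finally show ?thesis unfolding V_def .
qed

section \<open>Taylor coefficients on the disc and the area of the image\<close>

lemma holomorphic_unit_disc_series:
  fixes h :: "complex \<Rightarrow> complex"
  assumes h: "h holomorphic_on ball 0 1" and z: "cmod z < 1"
  shows "(\<lambda>n. (deriv ^^ n) h 0 / fact n * z ^ n) sums h z"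
    and "summable (\<lambda>n. cmod ((deriv ^^ n) h 0 / fact n * z ^ n))"
proof -
  have *: "(\<lambda>n. (deriv ^^ n) h 0 / fact n * w ^ n) sums h w" if "cmod w < 1" for w
    using holomorphic_power_series[OF h, of w] that by simp
  show "(\<lambda>n. (deriv ^^ n) h 0 / fact n * z ^ n) sums h z" using * z .
  obtain x where x: "cmod z < x" "x < 1" using dense z by blast
  then have x0: "0 \<le> x" using norm_ge_zero[of z] by linarith
  \<comment> \<open>Convergence at a point of larger modulus forces absolute convergence at
    \<open>z\<close>.\<close>
  have "summable (\<lambda>n. (deriv ^^ n) h 0 / fact n * of_real x ^ n)"
    using *[of "of_real x"] x x0 by (auto simp: sums_iff)
  then show "summable (\<lambda>n. cmod ((deriv ^^ n) h 0 / fact n * z ^ n))"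
    using x x0 by (intro powser_insidea[where x = "of_real x"]) auto
qed

lemma holomorphic_unit_disc_deriv_series:
  fixes h :: "complex \<Rightarrow> complex"
  assumes h: "h holomorphic_on ball 0 1" and z: "cmod z < 1"
  defines "a \<equiv> \<lambda>n. (deriv ^^ n) h 0 / fact n"
  shows "(\<lambda>n. of_nat (Suc n) * a (Suc n) * z ^ n) sums deriv h z"
    and "summable (\<lambda>n. cmod (of_nat (Suc n) * a (Suc n) * z ^ n))"
proof -
  have dh: "deriv h holomorphic_on ball 0 1" using h by (intro holomorphic_deriv) auto
  have "(deriv ^^ n) (deriv h) 0 / fact n = of_nat (Suc n) * a (Suc n)" for n
    by (simp add: a_def funpow_swap1 fact_reduce field_simps del: of_nat_Suc)
  with holomorphic_unit_disc_series[OF dh z]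
  show "(\<lambda>n. of_nat (Suc n) * a (Suc n) * z ^ n) sums deriv h z"
    "summable (\<lambda>n. cmod (of_nat (Suc n) * a (Suc n) * z ^ n))" by simp_all
qed

text \<open>Logarithmic polar coordinates: \<open>w \<mapsto> g (exp (- w))\<close> is injective on the half strip
  \<open>0 < Re w\<close>, \<open>0 < Im w < 2 * pi\<close> and covers \<open>\<Omega>\<close> up to the image of a radius. Omitting that
  image only decreases the area, so a conformal change of variables and Fubini suffice.\<close>

lemma image_area_coeffs_le:
  assumes g: "conformal_onto g (ball 0 1) \<Omega>" and "open \<Omega>" and f: "f holomorphic_on \<Omega>"
    and fin: "image_area f \<Omega> < \<infinity>"
  defines "a \<equiv> \<lambda>n. (deriv ^^ n) (f \<circ> g) 0 / fact n"
  shows "ennreal (pi * (\<Sum>n<N. real n * (cmod (a n))\<^sup>2)) \<le> image_area f \<Omega>"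
proof -
  define V where "V = {w. 0 < Re w \<and> 0 < Im w \<and> Im w < 2*pi}"
  have "V = {w. 0 < Re w} \<inter> {w. 0 < Im w} \<inter> {w. Im w < 2*pi}" by (auto simp: V_def)
  then have oV: "open V"
    by (simp add: open_Int open_halfspace_Re_gt open_halfspace_Im_gt open_halfspace_Im_lt)
  define G where "G = (\<lambda>w. g (exp (-w)))"
  define k where "k = (\<lambda>w. exp (-w) * deriv (f \<circ> g) (exp (-w)))"
  have gh: "g holomorphic_on ball 0 1" and ginj: "inj_on g (ball 0 1)" and gim: "g ` ball 0 1 = \<Omega>"
    using g by (auto simp: conformal_onto_def)
  have h: "f \<circ> g holomorphic_on ball 0 1"
    using gh f gim by (auto intro: holomorphic_on_compose)
  have ball: "exp (-w) \<in> ball 0 1" if "0 < Re w" for w :: complex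
    using that by simp
  have G: "G holomorphic_on V"
  proof -
    have 1: "(\<lambda>w. exp (-w)) holomorphic_on V" by (intro holomorphic_intros)
    have 2: "(\<lambda>w. exp (-w)) ` V \<subseteq> ball 0 1" 
      by (rule image_subsetI, rule ball) (simp add: V_def)
    show ?thesis
      using holomorphic_on_compose_gen[OF 1 gh 2] by (simp add: G_def o_def)
  qed
  have Ginj: "inj_on G V"
  proof (rule inj_onI)
    fix v w assume vw: "v \<in> V" "w \<in> V" "G v = G w"
    then have "exp (-v) = exp (-w)"
      by (intro inj_onD[OF ginj, of "exp (-v)" "exp (-w)"] ball) (simp_all add: G_def V_def)
    moreover have "\<bar>Im (-v) - Im (-w)\<bar> < 2 * pi" using vw by (auto simp: V_def)
    ultimately have "-v = -w" using exp_complex_eqI by blast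
    then show "v = w" by simp
  qed
  have GV: "G ` V \<subseteq> \<Omega>" using ball gim by (intro image_subsetI) (simp only: G_def V_def mem_Collect_eq, blast)
  have oGV: "open (G ` V)" using open_mapping_thm3[OF G oV Ginj] .
  have area_sub: "(\<integral>\<^sup>+z\<in>G ` V. ennreal ((cmod (deriv f z))\<^sup>2) \<partial>lborel) \<le> image_area f \<Omega>"
    unfolding image_area_def using GV by (intro nn_integral_mono) (auto simp: indicator_def)
  have cont: "continuous_on (G ` V) (\<lambda>z. (cmod (deriv f z))\<^sup>2)"
    using GV \<open>open \<Omega>\<close> f
    by (intro continuous_intros continuous_on_subset[OF holomorphic_on_imp_continuous_on[OF holomorphic_deriv]])
  \<comment> \<open>By the chain rule \<open>k\<close> is minus the derivative of
    \<open>f \<circ> G\<close>, and the modulus absorbs the sign.\<close>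
  have kG: "(cmod (k w))\<^sup>2 = (cmod (deriv f (G w)))\<^sup>2 * (cmod (deriv G w))\<^sup>2" if "w \<in> V" for w
  proof -
    have w: "exp (-w) \<in> ball 0 1" using that by (intro ball) (simp add: V_def)
    have dg: "(g has_field_derivative deriv g (exp (-w))) (at (exp (-w)))"
      using gh w by (intro holomorphic_derivI) auto
    have df: "(f has_field_derivative deriv f (G w)) (at (G w))"
      using f \<open>open \<Omega>\<close> GV that by (intro holomorphic_derivI) auto
    have "(G has_field_derivative deriv g (exp (-w)) * (- exp (-w))) (at w)"
      unfolding G_def by (rule DERIV_chain2[where f = g and g = "\<lambda>w. exp (-w)", OF dg]) (auto intro!: derivative_eq_intros)
    then have 1: "deriv G w = deriv g (exp (-w)) * (- exp (-w))" by (rule DERIV_imp_deriv)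
    have "(f \<circ> g has_field_derivative deriv f (G w) * deriv g (exp (-w))) (at (exp (-w)))"
      using df dg unfolding G_def by (rule DERIV_chain)
    then have "deriv (f \<circ> g) (exp (-w)) = deriv f (G w) * deriv g (exp (-w))"
      by (rule DERIV_imp_deriv)
    with 1 show ?thesis by (simp add: k_def norm_mult power_mult_distrib)
  qed
  have "ennreal (pi * (\<Sum>n<N. real n * (cmod (a n))\<^sup>2)) \<le> (\<integral>\<^sup>+w\<in>V. ennreal ((cmod (k w))\<^sup>2) \<partial>lborel)"
    unfolding V_def
  proof (rule strip_area_ge)
    have "deriv (f \<circ> g) holomorphic_on ball 0 1" using h by (intro holomorphic_deriv) auto
    then have c: "continuous_on (ball 0 1) (deriv (f \<circ> g))"
      by (rule holomorphic_on_imp_continuous_on)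
    have "continuous_on {w. 0 < Re w \<and> 0 < Im w \<and> Im w < 2*pi} (\<lambda>w. deriv (f \<circ> g) (exp (-w)))"
    proof (rule continuous_on_compose2[OF c])
      show "continuous_on {w. 0 < Re w \<and> 0 < Im w \<and> Im w < 2*pi} (\<lambda>w. exp (-w))"
        by (intro continuous_intros)
    qed (rule image_subsetI, rule ball, simp)
    then show "continuous_on {w. 0 < Re w \<and> 0 < Im w \<and> Im w < 2*pi} k"
      unfolding k_def by (intro continuous_on_mult continuous_on_exp continuous_on_minus continuous_on_id)
    fix w :: complex assume "0 < Re w"
    then have w: "cmod (exp (-w)) < 1" by simp
    have *: "(\<lambda>n. of_nat (Suc n) * a (Suc n) * exp (-w) ^ n) sums deriv (f \<circ> g) (exp (-w))"
      "summable (\<lambda>n. cmod (of_nat (Suc n) * a (Suc n) * exp (-w) ^ n))"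
      unfolding a_def by (rule holomorphic_unit_disc_deriv_series[OF h w])+
    have e: "(\<lambda>n. exp (-w) * (of_nat (Suc n) * a (Suc n) * exp (-w) ^ n)) = 
       (\<lambda>n. of_nat (Suc n) * a (Suc n) * exp (-w) ^ (Suc n))" by (simp add: mult_ac)
    have "(\<lambda>n. of_nat (Suc n) * a (Suc n) * exp (-w) ^ (Suc n)) sums k w"
      using sums_mult[OF *(1), of "exp (-w)"] unfolding e k_def .
    \<comment> \<open>Multiplying the series of the derivative by \<open>exp (-w)\<close> restores
      the exponent \<open>Suc n\<close>; the term at index 0 of the shifted series vanishes because
      of its factor \<open>n\<close>.\<close>
    then show "k w = (\<Sum>n. of_nat n * a n * exp (-w) ^ n)"
      using sums_Suc_iff[of "\<lambda>n. of_nat n * a n * exp (-w) ^ n" "k w"] by (simp add: sums_iff)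
    have "(\<lambda>n. cmod (exp (-w)) * cmod (of_nat (Suc n) * a (Suc n) * exp (-w) ^ n)) =
      (\<lambda>n. cmod (of_nat (Suc n) * a (Suc n) * exp (-w) ^ (Suc n)))"
      by (simp add: norm_mult mult_ac)
    then have "summable (\<lambda>n. cmod (of_nat (Suc n) * a (Suc n) * exp (-w) ^ (Suc n)))"
      using summable_mult[OF *(2), of "cmod (exp (-w))"] by simp
    then show "summable (\<lambda>n. cmod (of_nat n * a n * exp (-w) ^ n))"
      by (subst (asm) summable_Suc_iff)
  qed
  also have "\<dots> = (\<integral>\<^sup>+w\<in>V. ennreal ((cmod (deriv f (G w)))\<^sup>2 * (cmod (deriv G w))\<^sup>2) \<partial>lborel)"
    by (intro nn_integral_cong) (auto simp: kG indicator_def)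
  also have "\<dots> = (\<integral>\<^sup>+z\<in>G ` V. ennreal ((cmod (deriv f z))\<^sup>2) \<partial>lborel)"
    using area_sub fin by (intro nn_integral_conformal_image oV G Ginj cont) auto
  also note area_sub
  finally show ?thesis .
qed

text \<open>Cauchy--Schwarz on \<open>(sqrt n * c n) * (r ^ n / sqrt n)\<close>; the second factor sums to
  \<open>- ln (1 - r\<^sup>2)\<close>.\<close>

lemma dirichlet_coeff_bound:
  fixes c :: "nat \<Rightarrow> real"
  assumes c: "\<And>n. 0 \<le> c n" and A: "\<And>N. pi * (\<Sum>n<N. real n * (c n)\<^sup>2) \<le> A"
    and r: "0 \<le> r" "r < 1" and sm: "summable (\<lambda>n. c n * r ^ n)"
  shows "(\<Sum>n. c n * r ^ n) - c 0 \<le> sqrt (A / pi * ln ((1 + r) / (1 - r)))"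
proof -
  have r2: "\<bar>- (r\<^sup>2)\<bar> < 1" using r by (simp add: power_less_one_iff abs_square_less_1)
  \<comment> \<open>At \<open>n = 0\<close> the term is \<open>1 / 0\<close>, whose value is 0, so
    the sum effectively starts at \<open>n = 1\<close>.\<close>
  have ln: "(\<lambda>n. (r\<^sup>2) ^ n / real n) sums - ln (1 - r\<^sup>2)"
    using sums_minus[OF ln_series'[OF r2]] by simp
  have "1 - r\<^sup>2 > 0" using r2 by simp
  \<comment> \<open>The right side is the left side times \<open>(1 + r)\<^sup>2\<close>.\<close>
  have "inverse (1 - r\<^sup>2) \<le> (1 + r) / (1 - r)"
  proof -
    have "inverse (1 - r\<^sup>2) = 1 / ((1 + r) * (1 - r))" by (simp add: power2_eq_square field_simps)
    also have "\<dots> \<le> (1 + r) / (1 - r)"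
      using r mult_mono[of 1 "1 + r" 1 "1 + r"] by (simp add: divide_simps)
    finally show ?thesis .
  qed
  then have "ln (inverse (1 - r\<^sup>2)) \<le> ln ((1 + r) / (1 - r))"
    using \<open>1 - r\<^sup>2 > 0\<close> r by (subst ln_le_cancel_iff) auto
  then have L: "- ln (1 - r\<^sup>2) \<le> ln ((1 + r) / (1 - r))"
    using \<open>1 - r\<^sup>2 > 0\<close> by (simp add: ln_inverse)
  \<comment> \<open>Indices start at 1 so that division by the square root of the index is
    legitimate; the missing term is exactly the subtracted \<open>c 0\<close>.\<close>
  have "(\<Sum>n<N. c (Suc n) * r ^ Suc n) \<le> sqrt (A / pi * ln ((1 + r) / (1 - r)))" for N
  proof (rule real_le_rsqrt)
    have "(\<Sum>n<N. c (Suc n) * r ^ Suc n) = (\<Sum>n<N. (sqrt (Suc n) * c (Suc n)) * (r ^ Suc n / sqrt (Suc n)))"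
      by (intro sum.cong) auto
    then have "(\<Sum>n<N. c (Suc n) * r ^ Suc n)\<^sup>2 \<le> 
       (\<Sum>n<N. (sqrt (Suc n) * c (Suc n))\<^sup>2) * (\<Sum>n<N. (r ^ Suc n / sqrt (Suc n))\<^sup>2)"
      by (simp only: Cauchy_Schwarz_ineq_sum)
    also have "\<dots> \<le> (A / pi) * ln ((1 + r) / (1 - r))"
    proof (intro mult_mono sum_nonneg)
      have "(\<Sum>n<N. (sqrt (Suc n) * c (Suc n))\<^sup>2) = (\<Sum>n<Suc N. real n * (c n)\<^sup>2)"
        by (subst sum.lessThan_Suc_shift) (simp add: power_mult_distrib)
      also have "\<dots> \<le> A / pi" using A[of "Suc N"] by (simp only: pos_le_divide_eq[OF pi_gt_zero] mult.commute)
      finally show "(\<Sum>n<N. (sqrt (Suc n) * c (Suc n))\<^sup>2) \<le> A / pi" .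
      have "(\<Sum>n<N. (r ^ Suc n / sqrt (Suc n))\<^sup>2) = (\<Sum>n<Suc N. (r\<^sup>2) ^ n / real n)"
        by (subst sum.lessThan_Suc_shift) (simp add: power_divide power_mult[symmetric] mult_ac power_mult_distrib power2_eq_square)
      also have "\<dots> \<le> - ln (1 - r\<^sup>2)"
        using sum_le_suminf[of "\<lambda>n. (r\<^sup>2) ^ n / real n" "{..<Suc N}"] ln by (simp add: sums_iff)
      finally show "(\<Sum>n<N. (r ^ Suc n / sqrt (Suc n))\<^sup>2) \<le> ln ((1 + r) / (1 - r))" using L by simp
      show "0 \<le> A / pi" using A[of 0] by simp
    qed auto
    finally show "(\<Sum>n<N. c (Suc n) * r ^ Suc n)\<^sup>2 \<le> A / pi * ln ((1 + r) / (1 - r))" .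
  qed
  moreover have "(\<lambda>n. c (Suc n) * r ^ Suc n) sums ((\<Sum>n. c n * r ^ n) - c 0)"
    using summable_sums[OF sm] by (subst sums_Suc_iff) simp
  ultimately show ?thesis
    unfolding sums_def by (intro LIMSEQ_le_const2[of _ _ "sqrt (A / pi * ln ((1 + r) / (1 - r)))"]) auto
qed

subsection \<open>The hyperbolic density\<close>

lemma conformal_onto_compose:
  assumes "conformal_onto g V W" "conformal_onto f U V"
  shows "conformal_onto (g \<circ> f) U W"
  using assms unfolding conformal_onto_def
  by (auto intro: holomorphic_on_compose comp_inj_on simp: image_comp[symmetric])

lemma conformal_onto_inverse:
  assumes g: "conformal_onto g U V" and U: "open U"
  obtains k where "conformal_onto k V U" "\<And>z. z \<in> U \<Longrightarrow> k (g z) = z" "\<And>w. w \<in> V \<Longrightarrow> g (k w) = w"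
proof -
  have gs: "g holomorphic_on U" "inj_on g U" "g ` U = V"
    using g by (auto simp: conformal_onto_def)
  obtain k where k: "k holomorphic_on V" "\<And>z. z \<in> U \<Longrightarrow> k (g z) = z"
    using holomorphic_has_inverse[OF gs(1) U gs(2)] gs(3) by metis
  have gk: "g (k w) = w" if "w \<in> V" for w using that gs(3) k(2) by auto
  have "inj_on k V" using gk by (metis inj_onI)
  moreover have "k ` V = U" using k(2) gs(3) by force
  ultimately show ?thesis using that[of k] k gk by (auto simp: conformal_onto_def)
qed

lemma conformal_onto_deriv_nonzero:
  assumes "conformal_onto g U V" "open U" "z \<in> U"
  shows "deriv g z \<noteq> 0"
  using assms holomorphic_injective_imp_regular unfolding conformal_onto_def by blast

text \<open>Parameter \<open>-a\<close> sends 0 to \<open>a\<close>. The maps with parameters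
  \<open>a\<close> and \<open>-a\<close> are mutually inverse self-maps of the disc, which yields
  injectivity and surjectivity.\<close>

lemma conformal_onto_Moebius:
  assumes "a \<in> ball 0 1"
  shows "conformal_onto (Moebius_function 0 (-a)) (ball 0 1) (ball 0 1)"
proof -
  have inv: "Moebius_function 0 b (Moebius_function 0 (-b) z) = z" "Moebius_function 0 b z \<in> ball 0 1"
    if "b \<in> ball 0 1" "z \<in> ball 0 1" for b z
    using that Moebius_function_compose[of b "-b" z] Moebius_function_norm_lt_1[of b z] by auto
  have "inj_on (Moebius_function 0 (-a)) (ball 0 1)"
    using inv(1)[OF assms] by (metis inj_onI)
  moreover have "Moebius_function 0 (-a) ` ball 0 1 = ball 0 1"
  proof (intro equalityI subsetI)
    fix z assume z: "z \<in> ball (0::complex) 1"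
    have "-a \<in> ball 0 1" using assms by simp
    from inv(1)[OF this z] have "Moebius_function 0 (-a) (Moebius_function 0 a z) = z" by simp
    then show "z \<in> Moebius_function 0 (-a) ` ball 0 1"
      using inv(2)[OF assms z] by (metis image_eqI)
  qed (use inv(2)[of "-a"] assms in auto)
  ultimately show ?thesis
    using Moebius_function_holomorphic[of "-a" 0] assms by (simp add: conformal_onto_def)
qed

text \<open>Moving an arbitrary point to the centre prepares for the Schwarz lemma. The factor
  \<open>1 - (cmod a)\<^sup>2\<close> is the derivative at 0 of the Moebius map, and equals
  \<open>2 / disc_density a\<close>.\<close>

lemma conformal_recentre:
  assumes g: "conformal_onto g (ball 0 1) \<Omega>" and a: "a \<in> ball 0 1"
  obtains G where "conformal_onto G (ball 0 1) \<Omega>" "G 0 = g a"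
    "cmod (deriv G 0) = cmod (deriv g a) * (1 - (cmod a)\<^sup>2)"
proof
  let ?M = "Moebius_function 0 (-a)"
  show "conformal_onto (g \<circ> ?M) (ball 0 1) \<Omega>"
    using conformal_onto_compose[OF g conformal_onto_Moebius[OF a]] .
  show "(g \<circ> ?M) 0 = g a" by (simp add: Moebius_function_of_zero)
  have "(?M has_field_derivative (1 - a * cnj a)) (at 0)"
    unfolding Moebius_function_def by (auto intro!: derivative_eq_intros)
  moreover have "(g has_field_derivative deriv g a) (at (?M 0))"
    using g a by (auto simp: Moebius_function_of_zero conformal_onto_def intro: holomorphic_derivI)
  ultimately have "(g \<circ> ?M has_field_derivative deriv g a * (1 - a * cnj a)) (at 0)"
    by (rule DERIV_chain[rotated])
  then have "deriv (g \<circ> ?M) 0 = deriv g a * (1 - a * cnj a)" by (rule DERIV_imp_deriv)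
  moreover have "1 - a * cnj a = of_real (1 - (cmod a)\<^sup>2)"
    by (simp add: complex_norm_square del: of_real_power)
  moreover have "1 - (cmod a)\<^sup>2 \<ge> 0"
    using a by (simp add: power_le_one)
  ultimately show "cmod (deriv (g \<circ> ?M) 0) = cmod (deriv g a) * (1 - (cmod a)\<^sup>2)"
    by (simp only: norm_mult norm_of_real abs_of_nonneg)
qed

text \<open>Schwarz's lemma applied to the inverse of \<open>g2\<close> after \<open>g1\<close>, a
  self-map of the disc fixing 0. Exchanging the two maps later gives equality.\<close>

lemma conformal_deriv_zero_le:
  assumes g1: "conformal_onto g1 (ball 0 1) \<Omega>" and g2: "conformal_onto g2 (ball 0 1) \<Omega>"
    and 0: "g1 0 = g2 0"
  shows "cmod (deriv g1 0) \<le> cmod (deriv g2 0)"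
proof -
  obtain k where k: "conformal_onto k \<Omega> (ball 0 1)" "\<And>z. z \<in> ball 0 1 \<Longrightarrow> k (g2 z) = z"
     "\<And>w. w \<in> \<Omega> \<Longrightarrow> g2 (k w) = w"
    using conformal_onto_inverse[OF g2] by auto
  have \<phi>: "conformal_onto (k \<circ> g1) (ball 0 1) (ball 0 1)"
    using conformal_onto_compose k(1) g1 .
  have \<phi>0: "(k \<circ> g1) 0 = 0" using k(2)[of 0] 0 by simp
  have \<phi>_hol: "k \<circ> g1 holomorphic_on ball 0 1" using \<phi> by (simp add: conformal_onto_def)
  have "cmod ((k \<circ> g1) z) < 1" if "cmod z < 1" for z
  proof -
    have "(k \<circ> g1) z \<in> (k \<circ> g1) ` ball 0 1" using that by (intro imageI) simp
    with \<phi> show ?thesis by (simp add: conformal_onto_def)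
  qed
  then have le: "cmod (deriv (k \<circ> g1) 0) \<le> 1"
    using Schwarz_Lemma(2)[OF \<phi>_hol \<phi>0, of 0] by (simp only: norm_zero zero_less_one)
  have d: "(g2 has_field_derivative deriv g2 0) (at ((k \<circ> g1) 0))"
    unfolding \<phi>0 using g2 by (intro holomorphic_derivI[of _ "ball 0 1"]) (auto simp: conformal_onto_def)
  have "(k \<circ> g1 has_field_derivative deriv (k \<circ> g1) 0) (at 0)"
    using \<phi>_hol by (intro holomorphic_derivI[of _ "ball 0 1"]) auto
  from DERIV_chain[OF d this]
  have "(g2 \<circ> (k \<circ> g1) has_field_derivative deriv g2 0 * deriv (k \<circ> g1) 0) (at 0)" .
  then have "(g1 has_field_derivative deriv g2 0 * deriv (k \<circ> g1) 0) (at 0)"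
    by (rule has_field_derivative_transform_within_open[OF _ open_ball[of 0 1]])
       (use k(3) g1 in \<open>auto simp: conformal_onto_def\<close>)
  then have "deriv g1 0 = deriv g2 0 * deriv (k \<circ> g1) 0" by (rule DERIV_imp_deriv)
  then show ?thesis using le mult_left_mono[OF le, of "cmod (deriv g2 0)"] by (simp add: norm_mult)
qed

lemma disc_density_pos: "z \<in> ball 0 1 \<Longrightarrow> 0 < disc_density z"
  by (simp add: disc_density_def abs_square_less_1)

text \<open>The definite description needs existence and uniqueness. Recentring reduces the
  independence of the quotient \<open>disc_density z / cmod (deriv g z)\<close> to equality of
  derivatives at 0; uniqueness holds because an injective holomorphic map has nonzero
  derivative.\<close>

lemma hyp_density_eq:
  assumes g: "conformal_onto g (ball 0 1) \<Omega>" and z: "z \<in> ball 0 1"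
  shows "hyp_density \<Omega> (g z) * cmod (deriv g z) = disc_density z"
proof -
  have indep: "disc_density z1 / cmod (deriv g1 z1) = disc_density z2 / cmod (deriv g2 z2)"
    if g1: "conformal_onto g1 (ball 0 1) \<Omega>" and g2: "conformal_onto g2 (ball 0 1) \<Omega>"
    and z1: "z1 \<in> ball 0 1" and z2: "z2 \<in> ball 0 1" and e: "g1 z1 = g2 z2" for g1 g2 z1 z2
  proof -
    obtain G1 where G1: "conformal_onto G1 (ball 0 1) \<Omega>" "G1 0 = g1 z1"
      "cmod (deriv G1 0) = cmod (deriv g1 z1) * (1 - (cmod z1)\<^sup>2)"
      using conformal_recentre[OF g1 z1] .
    obtain G2 where G2: "conformal_onto G2 (ball 0 1) \<Omega>" "G2 0 = g2 z2"
      "cmod (deriv G2 0) = cmod (deriv g2 z2) * (1 - (cmod z2)\<^sup>2)"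
      using conformal_recentre[OF g2 z2] .
    have "cmod (deriv G1 0) = cmod (deriv G2 0)"
      using conformal_deriv_zero_le[OF G1(1) G2(1)] conformal_deriv_zero_le[OF G2(1) G1(1)] G1(2) G2(2) e by simp
    with G1(3) G2(3) 
    have "cmod (deriv g1 z1) * (1 - (cmod z1)\<^sup>2) = cmod (deriv g2 z2) * (1 - (cmod z2)\<^sup>2)" by simp
    then show ?thesis by (simp add: disc_density_def mult.commute)
  qed
  have nz: "deriv g z \<noteq> 0" using conformal_onto_deriv_nonzero[OF g _ z] by simp
  have "hyp_density \<Omega> (g z) = disc_density z / cmod (deriv g z)"
    unfolding hyp_density_def
  proof (rule the_equality)
    show "\<forall>g' z'. conformal_onto g' (ball 0 1) \<Omega> \<and> z' \<in> ball 0 1 \<and> g' z' = g z \<longrightarrow>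
       disc_density z / cmod (deriv g z) * cmod (deriv g' z') = disc_density z'"
    proof (intro allI impI, elim conjE)
      fix g' z' assume *: "conformal_onto g' (ball 0 1) \<Omega>" "z' \<in> ball 0 1" "g' z' = g z"
      have "deriv g' z' \<noteq> 0" using conformal_onto_deriv_nonzero[OF *(1) _ *(2)] by simp
      then show "disc_density z / cmod (deriv g z) * cmod (deriv g' z') = disc_density z'"
        using indep[OF g *(1) z *(2)] *(3) by (simp add: field_simps)
    qed
    fix d assume "\<forall>g' z'. conformal_onto g' (ball 0 1) \<Omega> \<and> z' \<in> ball 0 1 \<and> g' z' = g z \<longrightarrow>
       d * cmod (deriv g' z') = disc_density z'"
    with g z have "d * cmod (deriv g z) = disc_density z" by blast
    with nz show "d = disc_density z / cmod (deriv g z)" by (simp add: field_simps)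
  qed
  with nz show ?thesis by simp
qed

lemma conformal_normalised_endpoints:
  assumes g: "conformal_onto g (ball 0 1) \<Omega>" and p: "p \<in> \<Omega>" and q: "q \<in> \<Omega>"
  obtains G r where "conformal_onto G (ball 0 1) \<Omega>" "G 0 = p" "0 \<le> r" "r < 1" "G (of_real r) = q"
proof -
  obtain a where a: "a \<in> ball 0 1" "g a = p" using g p by (auto simp: conformal_onto_def)
  obtain G where G: "conformal_onto G (ball 0 1) \<Omega>" "G 0 = p"
    using conformal_recentre[OF g a(1)] a(2) by metis
  obtain b where b: "b \<in> ball 0 1" "G b = q" using G q by (auto simp: conformal_onto_def)
  \<comment> \<open>A rotation taking \<open>cmod b\<close> to \<open>b\<close>. For
    \<open>b = 0\<close> the value \<open>sgn b\<close> would be 0, hence the exception.\<close>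
  define u where "u = (if b = 0 then 1 else sgn b)"
  have u: "cmod u = 1" "u * of_real (cmod b) = b"
    by (auto simp: u_def norm_sgn sgn_eq norm_divide)
  have "conformal_onto ((*) u) (ball 0 1) (ball 0 1)"
    unfolding conformal_onto_def
  proof (intro conjI)
    show "inj_on ((*) u) (ball 0 1)" using u by (auto intro!: inj_onI)
    show "(*) u ` ball 0 1 = ball 0 1"
    proof (intro equalityI subsetI)
      fix z assume "z \<in> ball (0::complex) 1"
      then have "z / u \<in> ball 0 1" "z = u * (z / u)" using u by (auto simp: norm_divide)
      then show "z \<in> (*) u ` ball 0 1" by blast
    qed (use u in \<open>auto simp: norm_mult\<close>)
  qed (intro holomorphic_intros)
  with G(1) have "conformal_onto (G \<circ> (*) u) (ball 0 1) \<Omega>"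
    by (rule conformal_onto_compose)
  then show ?thesis
    using that[of "G \<circ> (*) u" "cmod b"] G(2) b u by simp
qed

text \<open>The chain rule holds off the finite exceptional set, which is null. The density is
  arbitrary because both hyperbolic densities and moduli of derivatives are pulled back.\<close>

lemma arc_integral_compose:
  assumes g: "g holomorphic_on U" "open U" and s: "valid_path s" "path_image s \<subseteq> U"
  shows "arc_integral \<rho> (g \<circ> s) = arc_integral (\<lambda>z. \<rho> (g z) * cmod (deriv g z)) s"
proof -
  obtain S where S: "finite S" "s C1_differentiable_on ({0..1} - S)"
    using s unfolding valid_path_def piecewise_C1_differentiable_on_def by blast
  have eq: "cmod (vector_derivative (g \<circ> s) (at t)) = cmod (deriv g (s t)) * cmod (vector_derivative s (at t))"
    if t: "t \<in> {0..1} - S" for t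
  proof -
    have d: "s differentiable at t"
      using S(2) t by (auto simp: C1_differentiable_on_eq)
    have "s t \<in> U" using s t by (auto simp: path_image_def)
    then have "g field_differentiable at (s t)"
      using g holomorphic_on_imp_differentiable_at by blast
    with d show ?thesis
      by (simp add: vector_derivative_chain_at_general norm_mult)
  qed
  have "AE t in lborel. t \<notin> S"
    by (rule AE_not_in) (use S(1) finite_imp_null_set_lborel in blast)
  then show ?thesis
    unfolding arc_integral_def
    by (intro nn_integral_cong_AE) (auto elim!: eventually_mono simp: eq mult.assoc split: split_indicator)
qed

subsection \<open>Geodesics\<close>

text \<open>The function is twice the inverse hyperbolic tangent: hyperbolic distance from 0 along
  the real diameter, with sign.\<close>

lemma artanh_deriv:
  fixes x :: real
  assumes "\<bar>x\<bar> < 1"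
  shows "((\<lambda>x. ln (1 + x) - ln (1 - x)) has_real_derivative 2 / (1 - x\<^sup>2)) (at x)"
proof -
  have "1 - x\<^sup>2 = (1 + x) * (1 - x)" by (simp add: power2_eq_square algebra_simps)
  moreover have "1 + x > 0" "1 - x > 0" using assms by auto
  ultimately show ?thesis
    by (auto intro!: derivative_eq_intros simp: divide_simps)
qed

lemma disc_length_radial_segment:
  assumes r: "0 \<le> r" "r < 1"
  shows "arc_integral disc_density (linepath 0 (of_real r)) = ennreal (ln (1 + r) - ln (1 - r))"
proof -
  have "((\<lambda>t. 2 / (1 - (t * r)\<^sup>2) * r) has_integral
     ((ln (1 + 1 * r) - ln (1 - 1 * r)) - (ln (1 + 0 * r) - ln (1 - 0 * r)))) {0..1}"
  proof (rule fundamental_theorem_of_calculus)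
    fix t :: real assume "t \<in> {0..1}"
    then have "\<bar>t * r\<bar> < 1"
      using r mult_mono[of t 1 r r] by (auto simp: abs_mult)
    moreover have "((\<lambda>t. t * r) has_real_derivative r) (at t within {0..1})"
      by (auto intro!: derivative_eq_intros)
    ultimately show "((\<lambda>t. ln (1 + t * r) - ln (1 - t * r)) has_vector_derivative 2 / (1 - (t * r)\<^sup>2) * r) (at t within {0..1})"
      unfolding has_real_derivative_iff_has_vector_derivative[symmetric]
      using DERIV_chain2[where g = "\<lambda>t. t * r", OF artanh_deriv] by blast
  qed simp
  then have "(\<integral>\<^sup>+t\<in>{0..1}. ennreal (2 / (1 - (t * r)\<^sup>2) * r) \<partial>lborel) = ennreal (ln (1 + r) - ln (1 - r))"
    using r by (intro nn_integral_has_integral_lebesgue')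
      (auto intro!: mult_nonneg_nonneg divide_nonneg_nonneg simp: power_le_one mult_le_one)
  moreover have "disc_density (linepath 0 (of_real r) t) * cmod (vector_derivative (linepath 0 (of_real r)) (at t))
     = 2 / (1 - (t * r)\<^sup>2) * r" for t
    using r by (simp add: disc_density_def linepath_def norm_mult power_mult_distrib)
  ultimately show ?thesis by (simp add: arc_integral_def)
qed

text \<open>The left side is the rate of change of twice artanh of the real part, for a point
  \<open>z\<close> moving with velocity \<open>d\<close>. It loses twice: the density grows with
  \<open>cmod z\<close>, which is at least \<open>|Re z|\<close>, and
  \<open>Re d \<le> cmod d\<close>. Equality with \<open>d \<noteq> 0\<close> excludes both
  losses.\<close>

lemma radial_part_le_disc_speed:
  assumes z: "cmod z < 1"
  shows "2 / (1 - (Re z)\<^sup>2) * Re d \<le> disc_density z * cmod d"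
    and "2 / (1 - (Re z)\<^sup>2) * Re d = disc_density z * cmod d \<Longrightarrow> d = 0 \<or> Im z = 0 \<and> Re d = cmod d"
proof -
  have sq: "(cmod z)\<^sup>2 = (Re z)\<^sup>2 + (Im z)\<^sup>2" by (rule cmod_power2)
  have pos: "0 < 1 - (cmod z)\<^sup>2" using z by (simp add: abs_square_less_1)
  have pos'': "0 < 1 - (Re z)\<^sup>2" using pos sq zero_le_power2[of "Im z"] by linarith
  have "2 / (1 - (Re z)\<^sup>2) \<le> 2 / (1 - (cmod z)\<^sup>2)"
    using pos pos'' sq by (intro divide_left_mono mult_pos_pos) auto
  then have 1: "2 / (1 - (Re z)\<^sup>2) \<le> disc_density z" by (simp add: disc_density_def)
  have pos': "0 < 2 / (1 - (Re z)\<^sup>2)" using pos'' by simp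
  have 2: "2 / (1 - (Re z)\<^sup>2) * Re d \<le> 2 / (1 - (Re z)\<^sup>2) * cmod d"
    using pos' complex_Re_le_cmod[of d] by (intro mult_left_mono) auto
  have 3: "2 / (1 - (Re z)\<^sup>2) * cmod d \<le> disc_density z * cmod d"
    using 1 by (intro mult_right_mono) auto
  show "2 / (1 - (Re z)\<^sup>2) * Re d \<le> disc_density z * cmod d" using 2 3 by linarith
  assume eq: "2 / (1 - (Re z)\<^sup>2) * Re d = disc_density z * cmod d"
  have e2: "Re d = cmod d" using eq 2 3 pos' by (metis antisym less_irrefl mult_left_cancel)
  show "d = 0 \<or> Im z = 0 \<and> Re d = cmod d"
  proof (cases "d = 0")
    case False
    then have "2 / (1 - (Re z)\<^sup>2) = 2 / (1 - (cmod z)\<^sup>2)"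
      using eq e2 by (simp add: disc_density_def)
    then have "1 - (Re z)\<^sup>2 = 1 - (cmod z)\<^sup>2" using pos pos' by (simp add: field_simps)
    then show ?thesis using sq e2 by simp
  qed auto
qed

text \<open>Projecting a curve to the real axis decreases its hyperbolic length. If \<open>s\<close> is at most as
  long as the radius, the two speeds agree almost everywhere: wherever \<open>s\<close> moves, it is on the real
  axis and moves to the right. So integrals along \<open>s\<close> reduce to integrals over \<open>[0, r]\<close>.\<close>

lemma disc_geodesic_arc_integral:
  assumes s: "valid_path s" "path_image s \<subseteq> ball 0 1" "s 0 = 0" "s 1 = of_real r"
    and r: "0 \<le> r" "r < 1"
    and min: "arc_integral disc_density s \<le> ennreal (ln (1 + r) - ln (1 - r))"
  shows "arc_integral disc_density s = ennreal (ln (1 + r) - ln (1 - r))"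
    and "\<And>\<rho> F F'. \<lbrakk>\<And>x. \<bar>x\<bar> < 1 \<Longrightarrow> (F has_real_derivative F' x) (at x);
           \<And>x. \<lbrakk>0 \<le> x; x < 1\<rbrakk> \<Longrightarrow> 0 \<le> F' x \<and> \<rho> (of_real x) \<le> F' x\<rbrakk>
         \<Longrightarrow> arc_integral \<rho> s \<le> ennreal (F r - F 0)"
proof -
  define L where "L = ln (1 + r) - ln (1 - r)"
  have L0: "0 \<le> L" using r by (simp add: L_def)
  obtain S0 where S0: "finite S0" "s C1_differentiable_on ({0..1} - S0)"
    using s(1) unfolding valid_path_def piecewise_C1_differentiable_on_def by blast
  \<comment> \<open>Including the endpoints makes \<open>E\<close> open, so functions continuous on
    \<open>E\<close> become Borel measurable when cut off outside it.\<close>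
  define S where "S = S0 \<union> {0, 1}"
  define E where "E = {0..1} - S"
  define u where "u = (\<lambda>t. Re (s t))"
  define d where "d = (\<lambda>t. vector_derivative s (at t))"
  have finS: "finite S" using S0 by (simp add: S_def)
  have C1: "s C1_differentiable_on E"
    using S0(2) by (rule C1_differentiable_on_subset) (auto simp: E_def S_def)
  have "E = {0<..<1} - S" by (auto simp: E_def S_def)
  then have oE: "open E" using finS by (simp add: open_Diff finite_imp_closed)
  have ball: "cmod (s t) < 1" if "t \<in> {0..1}" for t
    using subsetD[OF s(2), of "s t"] that by (simp add: path_image_def)
  have conts: "continuous_on {0..1} s"
    using valid_path_imp_path[OF s(1)] by (simp add: path_def)
  have u1: "\<bar>u t\<bar> < 1" if "t \<in> {0..1}" for t
    using ball[OF that] abs_Re_le_cmod[of "s t"] by (simp add: u_def)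
  have der: "(u has_real_derivative Re (d t)) (at t)" if "t \<in> E" for t
  proof -
    have "(s has_vector_derivative d t) (at t)"
      using C1 that unfolding d_def by (auto simp: C1_differentiable_on_eq vector_derivative_works)
    then show ?thesis
      unfolding u_def has_real_derivative_iff_has_vector_derivative
      by (rule bounded_linear.has_vector_derivative[OF bounded_linear_Re])
  qed
  \<comment> \<open>Stated for the gauge integral, which allows finitely many exceptional points
    even if the derivative is unbounded near them. It serves three primitives: the artanh function,
    the identity, and the final \<open>F\<close>.\<close>
  have ftc: "((\<lambda>t. F' (u t) * Re (d t)) has_integral (F (u \<tau>) - F (u 0))) {0..\<tau>}"
    if F: "\<And>x. \<bar>x\<bar> < 1 \<Longrightarrow> (F has_real_derivative F' x) (at x)" and \<tau>: "\<tau> \<in> {0..1}" for F F' \<tau>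
  proof (rule fundamental_theorem_of_calculus_interior_strong[OF finS, of 0 \<tau> "\<lambda>t. F (u t)"])
    show "((\<lambda>t. F (u t)) has_vector_derivative F' (u t) * Re (d t)) (at t)" if "t \<in> {0<..<\<tau>} - S" for t
    proof -
      have "t \<in> E" using that \<tau> by (auto simp: E_def)
      then have "t \<in> {0..1}" by (simp add: E_def)
      from DERIV_chain2[OF F[OF u1[OF this]] der[OF \<open>t \<in> E\<close>]]
      show ?thesis by (simp add: has_real_derivative_iff_has_vector_derivative)
    qed
    have "continuous_on {-1<..<1} F"
      by (intro continuous_at_imp_continuous_on ballI DERIV_isCont[OF F]) auto
    moreover have "continuous_on {0..\<tau>} u"
      unfolding u_def using \<tau> by (intro continuous_intros continuous_on_subset[OF conts]) auto
    ultimately show "continuous_on {0..\<tau>} (\<lambda>t. F (u t))"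
    proof (rule continuous_on_compose2)
      show "u ` {0..\<tau>} \<subseteq> {- 1<..<1}"
      proof (rule image_subsetI)
        fix t assume "t \<in> {0..\<tau>}"
        then have "\<bar>u t\<bar> < 1" using \<tau> by (intro u1) auto
        then show "u t \<in> {- 1<..<1}" by auto
      qed
    qed
  qed (use \<tau> in auto)
  have AE_E: "AE t in lborel. t \<in> {0..1} \<longrightarrow> t \<in> E"
  proof -
    have "AE t in lborel. t \<notin> S"
      by (rule AE_not_in) (use finS finite_imp_null_set_lborel in blast)
    then show ?thesis by eventually_elim (auto simp: E_def)
  qed
  define v where "v = (\<lambda>t. disc_density (s t) * cmod (d t))"
  define w where "w = (\<lambda>t. 2 / (1 - (u t)\<^sup>2) * Re (d t))"
  have EI: "E \<subseteq> {0..1}" by (auto simp: E_def)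
  have contE: "continuous_on E s" using conts EI by (rule continuous_on_subset)
  have contd: "continuous_on E d"
    using C1 unfolding d_def by (simp add: C1_differentiable_on_eq)
  have sq1: "(cmod (s t))\<^sup>2 < 1" "(u t)\<^sup>2 < 1" if "t \<in> {0..1}" for t
    using ball[OF that] u1[OF that] by (auto simp: abs_square_less_1)
  have contv: "continuous_on E v"
    unfolding v_def disc_density_def using sq1 EI
    by (intro continuous_intros contE contd) (metis diff_gt_0_iff_gt less_irrefl subsetD)
  have contw: "continuous_on E w"
    unfolding w_def u_def using sq1 EI unfolding u_def
    by (intro continuous_intros contE contd) (metis diff_gt_0_iff_gt less_irrefl subsetD)
  have v0: "0 \<le> v t" if "t \<in> {0..1}" for t
    using disc_density_pos[of "s t"] ball[OF that] by (simp add: v_def)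
  have wv: "w t \<le> v t" if "t \<in> {0..1}" for t
    unfolding w_def v_def u_def by (rule radial_part_le_disc_speed(1)[OF ball[OF that]])
  have u01: "u 0 = 0" "u 1 = r" using s by (auto simp: u_def)
  have intw: "(w has_integral L) {0..1}"
    using ftc[of "\<lambda>x. ln (1 + x) - ln (1 - x)" "\<lambda>x. 2 / (1 - x\<^sup>2)" 1] artanh_deriv
    by (simp add: u01 w_def L_def)
  have arcv: "arc_integral disc_density s = (\<integral>\<^sup>+t. ennreal (indicator E t * v t) \<partial>lborel)"
    unfolding arc_integral_def
    by (intro nn_integral_cong_AE, use AE_E in eventually_elim)
       (use EI in \<open>auto simp: v_def d_def indicator_def\<close>)
  obtain V where V: "0 \<le> V" "arc_integral disc_density s = ennreal V" "V \<le> L"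
    using min L0 unfolding L_def[symmetric]
    by (metis ennreal_cases ennreal_le_iff ennreal_less_top infinity_ennreal_def neq_top_trans order_le_less_trans less_irrefl)
  have "((\<lambda>t. indicator E t * v t) has_integral V) UNIV"
  proof (rule nn_integral_has_integral)
    show "(\<lambda>t. indicator E t * v t) \<in> borel_measurable borel"
      using borel_measurable_continuous_on_indicator[OF _ contv] oE by simp
  qed (use V arcv v0 EI in \<open>auto simp: indicator_def\<close>)
  moreover have eq: "(\<lambda>t. if t \<in> {0..1} then indicator E t * v t else 0) = (\<lambda>t. indicator E t * v t)"
    using EI by (intro ext) (auto simp: indicator_def)
  ultimately have "((\<lambda>t. if t \<in> {0..1} then indicator E t * v t else 0) has_integral V) UNIV"
    by (subst eq)
  then have "((\<lambda>t. indicator E t * v t) has_integral V) {0..1}"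
    by (rule has_integral_restrict_UNIV[THEN iffD1])
  then have intv: "(v has_integral V) {0..1}"
    by (rule has_integral_spike_finite[OF finS, rotated]) (auto simp: E_def)
  \<comment> \<open>Projection gives \<open>L \<le> V\<close>, the minimality assumption gives
    \<open>V \<le> L\<close>.\<close>
  have VL: "V = L" using has_integral_le[OF intw intv] wv V(3) by auto
  then show "arc_integral disc_density s = ennreal (ln (1 + r) - ln (1 - r))"
    using V(2) by (simp add: L_def)
  have "((\<lambda>t. v t - w t) has_integral 0) {0..1}"
    using has_integral_diff[OF intv intw] VL by simp
  \<comment> \<open>A nonnegative function with integral 0 vanishes almost everywhere; this is how
    equality of lengths becomes equality of speeds.\<close>
  then have "(\<integral>\<^sup>+t. ennreal (v t - w t) * indicator {0..1} t \<partial>lborel) = ennreal 0"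
    by (rule nn_integral_has_integral_lebesgue'[rotated]) (simp add: wv)
  moreover have "(\<integral>\<^sup>+t. ennreal (v t - w t) * indicator E t \<partial>lborel) \<le> (\<integral>\<^sup>+t. ennreal (v t - w t) * indicator {0..1} t \<partial>lborel)"
    using EI by (intro nn_integral_mono) (auto simp: indicator_def)
  ultimately have "(\<integral>\<^sup>+t. ennreal (v t - w t) * indicator E t \<partial>lborel) = 0" by simp
  moreover have "(\<lambda>t. ennreal (v t - w t) * indicator E t) \<in> borel_measurable borel"
    by (intro borel_measurable_ennreal_times_indicator oE continuous_intros contv contw)
  ultimately have "AE t in lborel. ennreal (v t - w t) * indicator E t = 0"
    by (subst (asm) nn_integral_0_iff_AE) auto
  then have "AE t in lborel. t \<in> E \<longrightarrow> v t = w t"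
  proof eventually_elim
    case (elim t)
    then show ?case using wv[of t] EI by (auto simp: indicator_def split: if_splits)
  qed
  then have "AE t in lborel. t \<in> {0..1} \<longrightarrow> t \<in> E \<and> v t = w t"
    using AE_E by eventually_elim auto
  then obtain N where N: "N \<in> null_sets lborel" "{t. \<not> (t \<in> {0..1} \<longrightarrow> t \<in> E \<and> v t = w t)} \<subseteq> N"
    unfolding eventually_ae_filter by auto
  have negN: "negligible N"
    using N(1) by (simp add: negligible_iff_null_sets null_sets_completionI)
  have good: "t \<in> E" "d t = 0 \<or> Im (s t) = 0 \<and> Re (d t) = cmod (d t)" if "t \<in> {0..1} - N" for t
  proof -
    have *: "t \<in> E" "v t = w t" using N(2) that by auto
    show "t \<in> E" by fact
    show "d t = 0 \<or> Im (s t) = 0 \<and> Re (d t) = cmod (d t)"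
      using radial_part_le_disc_speed(2)[of "s t" "d t"] ball[of t] *(2) that 
      by (simp add: v_def w_def u_def)
  qed
  then have dpos: "0 \<le> Re (d t)" if "t \<in> {0..1} - N" for t
    using that by (metis norm_ge_zero order_refl zero_complex.sel(1))
  \<comment> \<open>The majorant of \<open>\<rho>\<close> is assumed only on \<open>[0, 1)\<close>,
    so the curve must be kept off the negative axis. Its real part starts at 0 and almost never
    decreases.\<close>
  have upos: "0 \<le> u \<tau>" if \<tau>: "\<tau> \<in> {0..1}" for \<tau>
  proof -
    have "((\<lambda>t. 1 * Re (d t)) has_integral (u \<tau> - u 0)) {0..\<tau>}"
      using ftc[of "\<lambda>x. x" "\<lambda>_. 1" \<tau>] \<tau> by (auto intro: derivative_eq_intros)
    then have "((\<lambda>t. if t \<in> N then 0 else Re (d t)) has_integral (u \<tau> - u 0)) {0..\<tau>}"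
      by (rule has_integral_spike[OF negN, rotated]) auto
    then have "0 \<le> u \<tau> - u 0"
      by (rule has_integral_nonneg) (use dpos \<tau> in auto)
    then show ?thesis using u01 by simp
  qed
  fix \<rho> F F'
  assume F: "\<And>x. \<bar>x\<bar> < 1 \<Longrightarrow> (F has_real_derivative F' x) (at x)"
    and \<rho>: "\<And>x. \<lbrakk>0 \<le> x; x < 1\<rbrakk> \<Longrightarrow> 0 \<le> F' x \<and> \<rho> (complex_of_real x) \<le> F' x"
  \<comment> \<open>Set to 0 on the null set \<open>N\<close> so that it is nonnegative at every
    time in \<open>{0..1}\<close>, not merely almost every one.\<close>
  define k where "k = (\<lambda>t. if t \<in> N then 0 else F' (u t) * Re (d t))"
  have "((\<lambda>t. F' (u t) * Re (d t)) has_integral (F r - F 0)) {0..1}"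
    using ftc[OF F, of 1] u01 by simp
  then have "(k has_integral (F r - F 0)) {0..1}"
    by (rule has_integral_spike[OF negN, rotated]) (auto simp: k_def)
  then have k: "(\<integral>\<^sup>+t. ennreal (k t) * indicator {0..1} t \<partial>lborel) = ennreal (F r - F 0)"
  proof (rule nn_integral_has_integral_lebesgue'[rotated])
    fix t :: real assume t: "t \<in> {0..1}"
    show "0 \<le> k t" using \<rho>[of "u t"] upos[OF t] u1[OF t] dpos[of t] t by (auto simp: k_def)
  qed
  have "arc_integral \<rho> s \<le> (\<integral>\<^sup>+t. ennreal (k t) * indicator {0..1} t \<partial>lborel)"
    unfolding arc_integral_def
  proof (rule nn_integral_mono_AE)
    have "AE t in lborel. t \<notin> N" using N(1) by (rule AE_not_in)
    then show "AE t in lborel. ennreal (\<rho> (s t) * cmod (vector_derivative s (at t))) * indicator {0..1} t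
        \<le> ennreal (k t) * indicator {0..1} t"
    proof eventually_elim
      case (elim t)
      show ?case
      proof (cases "t \<in> {0..1}")
        case True
        have "\<rho> (s t) * cmod (d t) \<le> k t"
        \<comment> \<open>While the curve rests, the equality of speeds does not locate
          \<open>s t\<close>, but then both sides are 0.\<close>
        proof (cases "d t = 0")
          case False
          with good[of t] True elim have *: "Im (s t) = 0" "Re (d t) = cmod (d t)" by auto
          then have st: "s t = of_real (u t)" by (simp add: u_def complex_eq_iff)
          have "\<rho> (s t) \<le> F' (u t)"
            unfolding st using \<rho>[of "u t"] upos[OF True] u1[OF True] by auto
          then have "\<rho> (s t) * cmod (d t) \<le> F' (u t) * cmod (d t)" by (rule mult_right_mono) simp
          then show ?thesis using elim *(2) by (simp add: k_def)
        qed (simp add: k_def)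
        then show ?thesis using True by (simp add: d_def ennreal_leI)
      qed simp
    qed
  qed
  then show "arc_integral \<rho> s \<le> ennreal (F r - F 0)" unfolding k .
qed

section \<open>Transfer between the disc and the domain\<close>

lemma arc_integral_cong:
  assumes "\<And>z. z \<in> path_image \<gamma> \<Longrightarrow> \<rho> z = \<sigma> z"
  shows "arc_integral \<rho> \<gamma> = arc_integral \<sigma> \<gamma>"
  unfolding arc_integral_def using assms
  by (intro nn_integral_cong) (auto simp: path_image_def split: split_indicator)

lemma hyp_length_image_disc:
  assumes g: "conformal_onto g (ball 0 1) \<Omega>" and s: "valid_path s" "path_image s \<subseteq> ball 0 1"
  shows "hyp_length \<Omega> (g \<circ> s) = arc_integral disc_density s"
proof -
  have "hyp_length \<Omega> (g \<circ> s) = arc_integral (\<lambda>z. hyp_density \<Omega> (g z) * cmod (deriv g z)) s"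
    unfolding hyp_length_def
    using g by (intro arc_integral_compose[OF _ _ s]) (auto simp: conformal_onto_def)
  also have "\<dots> = arc_integral disc_density s"
    using s(2) by (intro arc_integral_cong hyp_density_eq[OF g]) auto
  finally show ?thesis .
qed

text \<open>Pulling \<open>\<gamma>\<close> back by the inverse of a normalised conformal map
  preserves hyperbolic length and the length of every holomorphic image, so the whole estimate can
  be carried out in the disc.\<close>

lemma geodesic_lift:
  assumes \<Omega>: "open \<Omega>" "\<exists>g. conformal_onto g (ball 0 1) \<Omega>" and geo: "hyp_geodesic_segment \<Omega> \<gamma>"
  obtains G s r where "conformal_onto G (ball 0 1) \<Omega>" "valid_path s" "path_image s \<subseteq> ball 0 1"
    "s 0 = 0" "s 1 = of_real r" "0 \<le> r" "r < 1"
    "arc_integral disc_density s = ennreal (ln (1 + r) - ln (1 - r))"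
    "hyp_length \<Omega> \<gamma> = ennreal (ln (1 + r) - ln (1 - r))"
    "\<And>f. f holomorphic_on \<Omega> \<Longrightarrow> euclidean_length_image f \<gamma> = arc_integral (\<lambda>z. cmod (deriv (f \<circ> G) z)) s"
proof -
  have \<gamma>: "valid_path \<gamma>" "path_image \<gamma> \<subseteq> \<Omega>"
    and min: "\<And>\<eta>. \<lbrakk>valid_path \<eta>; path_image \<eta> \<subseteq> \<Omega>; pathstart \<eta> = pathstart \<gamma>; pathfinish \<eta> = pathfinish \<gamma>\<rbrakk>
        \<Longrightarrow> hyp_length \<Omega> \<gamma> \<le> hyp_length \<Omega> \<eta>"
    using geo by (auto simp: hyp_geodesic_segment_def)
  have ends: "\<gamma> 0 \<in> \<Omega>" "\<gamma> 1 \<in> \<Omega>" using \<gamma>(2) by (auto simp: path_image_def)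
  obtain g where "conformal_onto g (ball 0 1) \<Omega>" using \<Omega>(2) by blast
  then obtain G r where G: "conformal_onto G (ball 0 1) \<Omega>" "G 0 = \<gamma> 0" "0 \<le> r" "r < 1" "G (of_real r) = \<gamma> 1"
    using conformal_normalised_endpoints ends by metis
  obtain k where k: "conformal_onto k \<Omega> (ball 0 1)" "\<And>z. z \<in> ball 0 1 \<Longrightarrow> k (G z) = z"
     "\<And>w. w \<in> \<Omega> \<Longrightarrow> G (k w) = w"
    using conformal_onto_inverse[OF G(1)] by auto
  have k_hol: "k holomorphic_on \<Omega>" and k_ball: "\<And>w. w \<in> \<Omega> \<Longrightarrow> k w \<in> ball 0 1"
    using k(1) by (auto simp: conformal_onto_def)
  have G_hol: "G holomorphic_on ball 0 1" and G_im: "\<And>z. z \<in> ball 0 1 \<Longrightarrow> G z \<in> \<Omega>"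
    using G(1) by (auto simp: conformal_onto_def)
  define s where "s = k \<circ> \<gamma>"
  have s: "valid_path s" "path_image s \<subseteq> ball 0 1"
    unfolding s_def using valid_path_compose_holomorphic[OF \<gamma>(1) k_hol \<Omega>(1) \<gamma>(2)] \<gamma>(2) k_ball
    by (auto simp: path_image_compose simp del: mem_ball)
  have s01: "s 0 = 0" "s 1 = of_real r"
    using k(2)[of 0] k(2)[of "of_real r"] G by (auto simp: s_def)
  have dG: "(G has_field_derivative deriv G z) (at z)" if "z \<in> ball 0 1" for z
    using G_hol that by (intro holomorphic_derivI) auto
  \<comment> \<open>Differentiating \<open>G (k w) = w\<close>; this cancels the two derivative
    factors in both pullbacks below.\<close>
  have Gk: "deriv G (k w) * deriv k w = 1" if w: "w \<in> \<Omega>" for w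
  proof -
    have "(k has_field_derivative deriv k w) (at w)"
      using k_hol \<Omega>(1) w by (intro holomorphic_derivI) auto
    from DERIV_chain[OF dG[OF k_ball[OF w]] this]
    have "(G \<circ> k has_field_derivative deriv G (k w) * deriv k w) (at w)" .
    then have "((\<lambda>w. w) has_field_derivative deriv G (k w) * deriv k w) (at w)"
      by (rule has_field_derivative_transform_within_open[OF _ \<Omega>(1) w]) (simp add: k(3))
    then show ?thesis using DERIV_ident DERIV_unique by blast
  qed
  have "arc_integral disc_density s = arc_integral (\<lambda>w. disc_density (k w) * cmod (deriv k w)) \<gamma>"
    unfolding s_def by (rule arc_integral_compose[OF k_hol \<Omega>(1) \<gamma>])
  also have "\<dots> = hyp_length \<Omega> \<gamma>"
    unfolding hyp_length_def
  proof (rule arc_integral_cong)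
    fix w assume "w \<in> path_image \<gamma>"
    then have w: "w \<in> \<Omega>" using \<gamma>(2) by auto
    have "disc_density (k w) = hyp_density \<Omega> w * cmod (deriv G (k w))"
      using hyp_density_eq[OF G(1) k_ball[OF w]] k(3)[OF w] by simp
    then have "disc_density (k w) * cmod (deriv k w) = hyp_density \<Omega> w * cmod (deriv G (k w) * deriv k w)"
      by (simp add: norm_mult)
    then show "disc_density (k w) * cmod (deriv k w) = hyp_density \<Omega> w" by (simp add: Gk[OF w])
  qed
  finally have hyp: "arc_integral disc_density s = hyp_length \<Omega> \<gamma>" .
  have seg: "path_image (linepath 0 (complex_of_real r)) \<subseteq> ball 0 1"
    
    using G(3,4) by (simp only: path_image_linepath) (intro closed_segment_subset convex_ball, auto)
  \<comment> \<open>Minimality is used against a single competitor, the image of the radius, which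
    has the same endpoints by the normalisation of \<open>G\<close>.\<close>
  have "hyp_length \<Omega> \<gamma> \<le> hyp_length \<Omega> (G \<circ> linepath 0 (of_real r))"
  proof (rule min)
    show "valid_path (G \<circ> linepath 0 (of_real r))"
      by (rule valid_path_compose_holomorphic[OF valid_path_linepath G_hol open_ball seg])
    show "path_image (G \<circ> linepath 0 (of_real r)) \<subseteq> \<Omega>"
      unfolding path_image_compose using seg G_im by blast
  qed (use G in \<open>auto simp: pathstart_def pathfinish_def linepath_def\<close>)
  also have "\<dots> = ennreal (ln (1 + r) - ln (1 - r))"
    using hyp_length_image_disc[OF G(1) _ seg] disc_length_radial_segment[OF G(3,4)] by simp
  finally have le: "arc_integral disc_density s \<le> ennreal (ln (1 + r) - ln (1 - r))" unfolding hyp .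
  have L: "arc_integral disc_density s = ennreal (ln (1 + r) - ln (1 - r))"
    by (rule disc_geodesic_arc_integral(1)[OF s s01 G(3,4) le])
  have img: "euclidean_length_image f \<gamma> = arc_integral (\<lambda>z. cmod (deriv (f \<circ> G) z)) s"
    if f: "f holomorphic_on \<Omega>" for f
  proof -
    have "arc_integral (\<lambda>z. cmod (deriv (f \<circ> G) z)) s = arc_integral (\<lambda>w. cmod (deriv (f \<circ> G) (k w)) * cmod (deriv k w)) \<gamma>"
      unfolding s_def by (rule arc_integral_compose[OF k_hol \<Omega>(1) \<gamma>])
    also have "\<dots> = arc_integral (\<lambda>w. cmod (deriv f w)) \<gamma>"
    proof (rule arc_integral_cong)
      fix w assume "w \<in> path_image \<gamma>"
      then have w: "w \<in> \<Omega>" using \<gamma>(2) by auto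
      have "(f has_field_derivative deriv f w) (at (G (k w)))"
        using f \<Omega>(1) w by (simp add: k(3) holomorphic_derivI)
      from DERIV_chain[OF this dG[OF k_ball[OF w]]]
      have "deriv (f \<circ> G) (k w) = deriv f w * deriv G (k w)" by (rule DERIV_imp_deriv)
      then have "cmod (deriv (f \<circ> G) (k w)) * cmod (deriv k w) = cmod (deriv f w) * cmod (deriv G (k w) * deriv k w)"
        by (simp add: norm_mult)
      then show "cmod (deriv (f \<circ> G) (k w)) * cmod (deriv k w) = cmod (deriv f w)" by (simp add: Gk[OF w])
    qed
    finally show ?thesis by (simp add: euclidean_length_image_def)
  qed
  show ?thesis by (rule that[OF G(1) s s01 G(3,4) L _ img]) (use hyp L in auto)
qed

text \<open>\<open>L\<close> is fixed before \<open>f\<close> and \<open>A\<close> are chosen, since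
  it depends on the geodesic alone; both inequalities of the theorem are instances.\<close>

lemma geodesic_image_length_le:
  assumes \<Omega>: "open \<Omega>" "\<exists>g. conformal_onto g (ball 0 1) \<Omega>" and geo: "hyp_geodesic_segment \<Omega> \<gamma>"
  obtains L where "0 \<le> L" "hyp_length \<Omega> \<gamma> = ennreal L"
    "\<And>f A. \<lbrakk>f holomorphic_on \<Omega>; image_area f \<Omega> = ennreal A; 0 \<le> A\<rbrakk>
       \<Longrightarrow> euclidean_length_image f \<gamma> \<le> ennreal (sqrt (A / pi * L))"
proof -
  obtain G s r where G: "conformal_onto G (ball 0 1) \<Omega>" and s: "valid_path s" "path_image s \<subseteq> ball 0 1"
    "s 0 = 0" "s 1 = of_real r" and r: "0 \<le> r" "r < 1"
    and L: "arc_integral disc_density s = ennreal (ln (1 + r) - ln (1 - r))"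
      "hyp_length \<Omega> \<gamma> = ennreal (ln (1 + r) - ln (1 - r))"
    and img: "\<And>f. f holomorphic_on \<Omega> \<Longrightarrow> euclidean_length_image f \<gamma> = arc_integral (\<lambda>z. cmod (deriv (f \<circ> G) z)) s"
    using geodesic_lift[OF assms] by metis
  have "euclidean_length_image f \<gamma> \<le> ennreal (sqrt (A / pi * (ln (1 + r) - ln (1 - r))))"
    if f: "f holomorphic_on \<Omega>" and A: "image_area f \<Omega> = ennreal A" "0 \<le> A" for f A
  proof -
    define h where "h = f \<circ> G"
    define a where "a = (\<lambda>n. (deriv ^^ n) h 0 / fact n)"
    define c where "c = (\<lambda>n. cmod (a n))"
    \<comment> \<open>\<open>F\<close> is the Taylor series of \<open>h\<close> with coefficients
      replaced by their moduli. Its derivative dominates \<open>|h'|\<close> on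
      \<open>[0, 1)\<close>, and \<open>F r - F 0\<close> is the coefficient sum without its
      constant term.\<close>
    define F where "F = (\<lambda>x. \<Sum>n. c n * x ^ n)"
    define F' where "F' = (\<lambda>x. \<Sum>n. diffs c n * x ^ n)"
    have h: "h holomorphic_on ball 0 1"
      using G f unfolding h_def conformal_onto_def by (metis holomorphic_on_compose)
    have sm: "summable (\<lambda>n. c n * x ^ n)" if "0 \<le> x" "x < 1" for x
      using holomorphic_unit_disc_series(2)[OF h, of "of_real x"] that
      by (simp add: c_def a_def norm_mult norm_power norm_divide)
    have F: "(F has_real_derivative F' x) (at x)" if x: "\<bar>x\<bar> < 1" for x
    proof -
      \<comment> \<open>Termwise differentiation at \<open>x\<close> requires convergence at some
        larger radius inside the disc.\<close>
      obtain K where "\<bar>x\<bar> < K" "K < 1" using dense x by blast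
      then show ?thesis unfolding F_def F'_def
        by (intro termdiffs_strong[where K = K] sm) auto
    qed
    have le: "0 \<le> F' x \<and> cmod (deriv h (of_real x)) \<le> F' x" if x: "0 \<le> x" "x < 1" for x
    proof -
      have x': "cmod (of_real x) < 1" using x by simp
      note ser = holomorphic_unit_disc_deriv_series[OF h x']
      have e: "cmod (of_nat (Suc n) * ((deriv ^^ Suc n) h 0 / fact (Suc n)) * of_real x ^ n) = diffs c n * x ^ n" for n
        using x by (simp add: diffs_def c_def a_def norm_mult norm_power norm_divide del: of_nat_Suc)
      have "deriv h (of_real x) = (\<Sum>n. of_nat (Suc n) * ((deriv ^^ Suc n) h 0 / fact (Suc n)) * of_real x ^ n)"
        using ser(1) by (simp only: sums_iff)
      then have "cmod (deriv h (of_real x)) \<le> F' x"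
        using summable_norm[OF ser(2)] unfolding e F'_def by simp
      then show ?thesis using norm_ge_zero[of "deriv h (of_real x)"] by linarith
    qed
    have "arc_integral disc_density s \<le> ennreal (ln (1 + r) - ln (1 - r))" by (simp add: L)
    from disc_geodesic_arc_integral(2)[OF s r this F le]
    have "arc_integral (\<lambda>z. cmod (deriv h z)) s \<le> ennreal (F r - F 0)" by simp
    also have "F r - F 0 \<le> sqrt (A / pi * ln ((1 + r) / (1 - r)))"
    proof -
      have "F 0 = c 0" by (simp add: F_def)
      moreover have "(\<Sum>n. c n * r ^ n) - c 0 \<le> sqrt (A / pi * ln ((1 + r) / (1 - r)))"
      proof (rule dirichlet_coeff_bound[OF _ _ r sm[OF r]])
        fix N
        have "ennreal (pi * (\<Sum>n<N. real n * (c n)\<^sup>2)) \<le> ennreal A"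
          using image_area_coeffs_le[OF G \<Omega>(1) f, of N] A
          by (simp add: c_def a_def h_def)
        then show "pi * (\<Sum>n<N. real n * (c n)\<^sup>2) \<le> A" using A(2) by (simp add: ennreal_le_iff)
      qed (simp add: c_def)
      ultimately show ?thesis by (simp add: F_def)
    qed
    finally show ?thesis
      using img[OF f] r by (simp add: h_def ln_div ennreal_leI)
  qed
  then show ?thesis using that[of "ln (1 + r) - ln (1 - r)"] L(2) r by simp
qed

theorem theorem3p1:
  fixes \<Omega> :: "complex set"
  assumes "open \<Omega>" and "connected \<Omega>"
    and "\<exists>g. conformal_onto g (ball 0 1) \<Omega>"
  shows "(\<forall>f \<gamma>. f analytic_on \<Omega> \<and> image_area f \<Omega> < \<infinity> \<and> hyp_geodesic_segment \<Omega> \<gamma> \<longrightarrow>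
            euclidean_length_image f \<gamma> \<le>
              ennreal_sqrt (image_area f \<Omega> / ennreal pi * hyp_length \<Omega> \<gamma>)) \<and>
         (\<forall>\<gamma>. emeasure lborel \<Omega> < \<infinity> \<and> hyp_geodesic_segment \<Omega> \<gamma> \<longrightarrow>
            ennreal pi * (euclidean_length \<gamma>)\<^sup>2 \<le> emeasure lborel \<Omega> * hyp_length \<Omega> \<gamma>)"
proof (intro conjI allI impI; elim conjE)
  fix f \<gamma>
  assume f: "f analytic_on \<Omega>" and fin: "image_area f \<Omega> < \<infinity>" and geo: "hyp_geodesic_segment \<Omega> \<gamma>"
  obtain L where L: "0 \<le> L" "hyp_length \<Omega> \<gamma> = ennreal L"
    "\<And>f A. \<lbrakk>f holomorphic_on \<Omega>; image_area f \<Omega> = ennreal A; 0 \<le> A\<rbrakk>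
       \<Longrightarrow> euclidean_length_image f \<gamma> \<le> ennreal (sqrt (A / pi * L))"
    using geodesic_image_length_le[OF assms(1,3) geo] by metis
  obtain A where A: "0 \<le> A" "image_area f \<Omega> = ennreal A"
    using fin by (cases "image_area f \<Omega>") auto
  have "ennreal_sqrt (image_area f \<Omega> / ennreal pi * hyp_length \<Omega> \<gamma>) = ennreal (sqrt (A / pi * L))"
    using A L by (simp add: divide_ennreal ennreal_mult[symmetric] ennreal_sqrt_def del: real_sqrt_mult)
  then show "euclidean_length_image f \<gamma> \<le> ennreal_sqrt (image_area f \<Omega> / ennreal pi * hyp_length \<Omega> \<gamma>)"
    using L(3)[OF analytic_imp_holomorphic[OF f] A(2,1)] by simp
next
  fix \<gamma>
  assume fin: "emeasure lborel \<Omega> < \<infinity>" and geo: "hyp_geodesic_segment \<Omega> \<gamma>"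
  obtain L where L: "0 \<le> L" "hyp_length \<Omega> \<gamma> = ennreal L"
    "\<And>f A. \<lbrakk>f holomorphic_on \<Omega>; image_area f \<Omega> = ennreal A; 0 \<le> A\<rbrakk>
       \<Longrightarrow> euclidean_length_image f \<gamma> \<le> ennreal (sqrt (A / pi * L))"
    using geodesic_image_length_le[OF assms(1,3) geo] by metis
  obtain A where A: "0 \<le> A" "emeasure lborel \<Omega> = ennreal A"
    using fin by (cases "emeasure lborel \<Omega>") auto
  \<comment> \<open>The second inequality is the estimate for the identity map, whose image area is
    the measure of \<open>\<Omega>\<close>, after squaring.\<close>
  have area: "image_area (\<lambda>z. z) \<Omega> = ennreal A"
    using A(2) assms(1) by (simp add: image_area_def)
  have "euclidean_length_image (\<lambda>z. z) \<gamma> = euclidean_length \<gamma>"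
    by (simp add: euclidean_length_image_def euclidean_length_def)
  then have "euclidean_length \<gamma> \<le> ennreal (sqrt (A / pi * L))"
    using L(3)[OF holomorphic_on_ident area A(1)] by simp
  then have "ennreal pi * (euclidean_length \<gamma>)\<^sup>2 \<le> ennreal pi * (ennreal (sqrt (A / pi * L)))\<^sup>2"
    by (intro mult_left_mono power_mono) auto
  also have "\<dots> = ennreal (pi * (sqrt (A / pi * L))\<^sup>2)"
    using A(1) L(1) by (simp only: ennreal_power ennreal_mult' real_sqrt_ge_zero pi_ge_zero
        divide_nonneg_nonneg mult_nonneg_nonneg)
  also have "pi * (sqrt (A / pi * L))\<^sup>2 = A * L"
    using A L by (simp del: real_sqrt_mult)
  finally show "ennreal pi * (euclidean_length \<gamma>)\<^sup>2 \<le> emeasure lborel \<Omega> * hyp_length \<Omega> \<gamma>"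
    using A L by (simp add: ennreal_mult)
qed

end
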